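(* Fix an admissible distribution $P$ on $[0,1]^n$. Under the Hölder-mean welfare $w_q$ with $q\in(-\infty,1]$, a fluid policy $\mathsf{F}$ attains a regret $$\mathcal{R}_T(\mathsf{F})=\mathbb{E}\left[\mathsf{OPT}-\mathsf{ALG}(\mathsf{F})\right]=O(1),$$ uniformly bounded over the time horizon length $T$, with the bound solely dependent on $P$.
   Context: There are $n$ agents and $T$ periods. $\Delta_n=\{x\in\mathbb{R}_+^n:\sum_i x^i=1\}$. A distribution $P$ on $[0,1]^n$ is admissible if it has finite support: $P\{b=\beta_\ell\}=p_\ell>0$ for $\ell\in[L]=\{1,\dots,L\}$, with distinct $\beta_\ell\in[0,1]^n$ and $\sum_\ell p_\ell=1$. The marginal utility vectors $b_1,\dots,b_T\in[0,1]^n$ are i.i.d. with law $P$; $N_\ell=\sum_{t=1}^T\mathbf{1}\{b_t=\beta_\ell\}$. Allocations $x_1,\dots,x_T\in\Delta_n$ give agent $i$ the cumulative utility $B_T^i=\sum_{t=1}^T b_t^i x_t^i$. Hölder means on $\mathbb{R}_+^n$: for $q\in(-\infty,0)$, $w_q(B)=\left(\frac1n\sum_i (B^i)^q\right)^{1/q}$ if all $B^i>0$ and $w_q(B)=0$ otherwise; $w_0(B)=\left(\prod_i B^i\right)^{1/n}$; for $q\in(0,1]$, $w_q(B)=\left(\frac1n\sum_i (B^i)^q\right)^{1/q}$. Hindsight optimum: $\mathsf{OPT}=\max\left\{w_q\left(\left(\sum_{t=1}^T b_t^i x_t^i\right)_{i\in[n]}\right): x_1,\dots,x_T\in\Delta_n\right\}$,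 computed for the realized sequence $b_1,\dots,b_T$. A static policy is a matrix $\boldsymbol\xi=(\xi_\ell)_{\ell\in[L]}\in\Delta_n^L$; it allocates $x_t=\xi_\ell$ whenever $b_t=\beta_\ell$, so $B_T^i=\sum_\ell N_\ell\beta_\ell^i\xi_\ell^i$, and its welfare is $\mathsf{ALG}(\boldsymbol\xi)=w_q(B_T)$. A fluid policy $\mathsf{F}$ is a static policy $\boldsymbol\xi^{\mathsf F}$ that is an optimal solution of the fluid problem $\max\left\{w_q\left(\left(T\sum_{\ell}p_\ell\beta_\ell^i\xi_\ell^i\right)_{i\in[n]}\right):\boldsymbol\xi\in\Delta_n^L\right\}$ (by homogeneity of $w_q$ the set of optimal solutions does not depend on $T$).
   Formalization: The regret bound is proved with a constant that may depend on q as well as on P (not on T or the choice of fluid policy); a bound depending solely on P, uniform over all q in (-∞,1], fails as q → -∞. *)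

theory Defs
  imports "HOL-Analysis.Analysis" "HOL-Probability.Probability"
begin

text \<open>
  The agents are the elements of a finite type \<open>'n\<close>, and \<open>n = CARD('n)\<close>. The atoms \<open>\<beta>\<^sub>l\<close> of a finitely
  supported distribution are indexed by themselves: they are the elements of \<^term>\<open>set_pmf P\<close>, and the
  atom \<open>\<beta>\<close> has probability \<^term>\<open>pmf P \<beta>\<close>.
\<close>

definition admissible :: "(real ^ 'n) pmf \<Rightarrow> bool" where
  "admissible P \<longleftrightarrow>
     finite (set_pmf P) \<and> (\<forall>\<beta>\<in>set_pmf P. \<forall>i. 0 \<le> \<beta> $ i \<and> \<beta> $ i \<le> 1)"

definition simplex_alloc :: "(real ^ 'n) set" where
  "simplex_alloc = {x. (\<forall>i. 0 \<le> x $ i) \<and> (\<Sum>i\<in>UNIV. x $ i) = 1}"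

text \<open>
  Only used for \<open>B\<close> with nonnegative components. Since \<open>0 powr a = 0\<close>, the two branches for \<open>q \<ge> 0\<close>
  are also correct when some components of \<open>B\<close> vanish.
\<close>

definition holder_mean :: "real \<Rightarrow> real ^ 'n \<Rightarrow> real" where
  "holder_mean q B =
     (if q < 0 then
        (if \<forall>i. 0 < B $ i
         then (1 / real CARD('n) * (\<Sum>i\<in>UNIV. (B $ i) powr q)) powr (1 / q)
         else 0)
      else if q = 0 then (\<Prod>i\<in>UNIV. B $ i) powr (1 / real CARD('n))
      else (1 / real CARD('n) * (\<Sum>i\<in>UNIV. (B $ i) powr q)) powr (1 / q))"

definition cum_utility ::
    "nat \<Rightarrow> (nat \<Rightarrow> real ^ 'n) \<Rightarrow> (nat \<Rightarrow> real ^ 'n) \<Rightarrow> real ^ 'n" where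
  "cum_utility T b x = (\<chi> i. \<Sum>t = 1..T. b t $ i * x t $ i)"

text \<open>
  The supremum is a maximum: for nonnegative \<open>b\<close> the objective is continuous in
  \<open>x 1, \<dots>, x T\<close>, which range over a nonempty compact set.
\<close>

definition hindsight_opt :: "real \<Rightarrow> nat \<Rightarrow> (nat \<Rightarrow> real ^ 'n) \<Rightarrow> real" where
  "hindsight_opt q T b =
     (SUP x\<in>{x. \<forall>t\<in>{1..T}. x t \<in> simplex_alloc}. holder_mean q (cum_utility T b x))"

text \<open>A static policy maps each atom of \<open>P\<close> to an allocation; values elsewhere are irrelevant.\<close>

definition static_policy :: "(real ^ 'n) pmf \<Rightarrow> (real ^ 'n \<Rightarrow> real ^ 'n) \<Rightarrow> bool" where
  "static_policy P \<xi> \<longleftrightarrow> (\<forall>\<beta>\<in>set_pmf P. \<xi> \<beta> \<in> simplex_alloc)"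

definition static_welfare ::
    "real \<Rightarrow> nat \<Rightarrow> (real ^ 'n \<Rightarrow> real ^ 'n) \<Rightarrow> (nat \<Rightarrow> real ^ 'n) \<Rightarrow> real" where
  "static_welfare q T \<xi> b = holder_mean q (cum_utility T b (\<lambda>t. \<xi> (b t)))"

definition fluid_value ::
    "(real ^ 'n) pmf \<Rightarrow> real \<Rightarrow> nat \<Rightarrow> (real ^ 'n \<Rightarrow> real ^ 'n) \<Rightarrow> real" where
  "fluid_value P q T \<xi> =
     holder_mean q (\<chi> i. real T * (\<Sum>\<beta>\<in>set_pmf P. pmf P \<beta> * \<beta> $ i * \<xi> \<beta> $ i))"

definition fluid_policy ::
    "(real ^ 'n) pmf \<Rightarrow> real \<Rightarrow> nat \<Rightarrow> (real ^ 'n \<Rightarrow> real ^ 'n) \<Rightarrow> bool" where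
  "fluid_policy P q T \<xi> \<longleftrightarrow>
     static_policy P \<xi> \<and> (\<forall>\<xi>'. static_policy P \<xi>' \<longrightarrow> fluid_value P q T \<xi>' \<le> fluid_value P q T \<xi>)"

text \<open>
  The law of \<open>(b 1, \<dots>, b T)\<close> for i.i.d. \<open>b t\<close> with law \<open>P\<close>. Outside \<open>{1..T}\<close> the sequence has the
  dummy value \<open>0\<close>, which is never used.
\<close>

definition arrivals :: "(real ^ 'n) pmf \<Rightarrow> nat \<Rightarrow> (nat \<Rightarrow> real ^ 'n) pmf" where
  "arrivals P T = Pi_pmf {1..T} 0 (\<lambda>_. P)"

definition regret :: "(real ^ 'n) pmf \<Rightarrow> real \<Rightarrow> nat \<Rightarrow> (real ^ 'n \<Rightarrow> real ^ 'n) \<Rightarrow> real" where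
  "regret P q T \<xi> =
     measure_pmf.expectation (arrivals P T) (\<lambda>b. hindsight_opt q T b - static_welfare q T \<xi> b)"

end

theory Submission
  imports Defs
begin

text \<open>
  Let \<open>u\<close> be the per-period utility vector of the fluid policy and \<open>g\<close> the gradient of the welfare
  \<open>w\<close> at \<open>u\<close>. As \<open>w\<close> is concave and homogeneous, \<open>w B \<le> g \<bullet> B\<close>, and by the first-order condition the
  fluid policy maximizes \<open>g \<bullet> B\<close> atom by atom, hence for every realization. Thus the hindsight optimum
  is at most \<open>g \<bullet> B\<^sub>T\<close>, and the regret is at most the mean of \<open>g \<bullet> B\<^sub>T - w B\<^sub>T\<close>. This gap
  vanishes at \<open>T u\<close> to second order, while \<open>B\<^sub>T - T u\<close> has variance \<open>O(T)\<close>; by homogeneity the two powers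
  of \<open>T\<close> cancel. In the coordinates \<open>r\<^sub>i = B\<^sub>i / u\<^sub>i\<close> the gap is that between the arithmetic and the power
  mean for the weights \<open>u\<^sub>i\<^sup>q / (\<Sum>j. u\<^sub>j\<^sup>q)\<close>. Testing the first-order condition against the policy
  serving only agent \<open>i\<close> bounds \<open>g\<^sub>i\<close> by the inverse mean of \<open>\<beta>\<^sup>i\<close>, uniformly over all optimal policies.
\<close>

section \<open>Weighted power means\<close>

lemma powr_le_tangent:
  fixes q r :: real
  assumes "0 \<le> q" "q \<le> 1" "0 \<le> r"
  shows "r powr q \<le> 1 + q * (r - 1)"
proof (cases "r = 0")
  case False
  then show ?thesis
    using Youngs_inequality_0[of q "1 - q" r 1] assms by (simp add: algebra_simps)
qed (use assms in auto)

text \<open>For \<open>s \<le> 0\<close> two linear bounds are chained, one for \<open>ln\<close>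
  and one for \<open>exp\<close>. For \<open>s \<ge> 1\<close> the concave bound
  \<open>powr_le_tangent\<close> is applied at the point \<open>y powr s\<close> with exponent
  \<open>1 / s\<close>.\<close>

lemma tangent_le_powr:
  fixes s y :: real
  assumes "0 < y" "s \<le> 0 \<or> 1 \<le> s"
  shows "1 + s * (y - 1) \<le> y powr s"
  using assms(2)
proof
  assume "s \<le> 0"
  have "1 + s * (y - 1) \<le> 1 + s * ln y"
    using \<open>s \<le> 0\<close> ln_le_minus_one[OF assms(1)] by (simp add: mult_left_mono_neg)
  also have "\<dots> \<le> exp (s * ln y)" by (rule exp_ge_add_one_self)
  finally show ?thesis using assms(1) by (simp add: powr_def)
next
  assume s: "1 \<le> s"
  have "(y powr s) powr (1 / s) \<le> 1 + 1 / s * (y powr s - 1)"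
    using s by (intro powr_le_tangent) auto
  with s assms(1) show ?thesis by (simp add: powr_powr field_simps)
qed

text \<open>From \<open>exp x - 1 \<le> x * exp x\<close> one gets
  \<open>exp x \<le> 1 + x + x * (exp x - 1)\<close>, and a linear bound on \<open>exp x - 1\<close>
  turns the last product into a square. The maximum covers both signs of \<open>x\<close>.\<close>

lemma exp_le_quadratic:
  fixes x :: real
  shows "exp x \<le> 1 + x + x\<^sup>2 * max 1 (exp x)"
proof -
  have "1 - x \<le> exp (- x)" using exp_ge_add_one_self[of "- x"] by simp
  then have 1: "exp x - 1 \<le> x * exp x"
    using mult_right_mono[of "1 - x" "exp (- x)" "exp x"] by (simp add: algebra_simps exp_minus)
  show ?thesis
  proof (cases "0 \<le> x")
    case True
    then have "x * (exp x - 1) \<le> x * (x * exp x)" by (intro mult_left_mono 1)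
    moreover have "x\<^sup>2 * exp x \<le> x\<^sup>2 * max 1 (exp x)" by (intro mult_left_mono) auto
    ultimately show ?thesis using 1 by (simp add: power2_eq_square algebra_simps)
  next
    case False
    then have "x * (exp x - 1) \<le> x * x"
      using exp_ge_add_one_self[of x] by (intro mult_left_mono_neg) linarith+
    moreover have "x\<^sup>2 \<le> x\<^sup>2 * max 1 (exp x)"
      by (simp add: mult_le_cancel_left1)
    ultimately show ?thesis using 1 by (simp add: power2_eq_square algebra_simps)
  qed
qed

text \<open>The bound \<open>ln r \<ge> 1 - 1 / r\<close> has the exact form
  \<open>(r - 1) - (r - 1)^2 / r\<close>, and \<open>1 / r \<le> 2\<close>.\<close>

lemma ln_ge_quadratic:
  fixes r :: real
  assumes "1 / 2 \<le> r"
  shows "(r - 1) - 2 * (r - 1)\<^sup>2 \<le> ln r"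
proof -
  have "(r - 1)\<^sup>2 / r \<le> (r - 1)\<^sup>2 / (1 / 2)"
    using assms by (intro divide_left_mono) auto
  then have "(r - 1) - 2 * (r - 1)\<^sup>2 \<le> (r - 1) - (r - 1)\<^sup>2 / r" by simp
  also have "\<dots> = 1 - 1 / r" using assms by (simp add: field_simps power2_eq_square)
  also have "\<dots> \<le> ln r" using ln_le_minus_one[of "1 / r"] assms by (simp add: ln_div)
  finally show ?thesis .
qed

text \<open>The Box-Cox transform: value 0 and slope 1 at \<open>r = 1\<close> for every
  \<open>q\<close>, with \<open>ln\<close> as the limit at \<open>q = 0\<close>. This normalization
  lets all exponents share one second-order analysis.\<close>

definition box_cox :: "real \<Rightarrow> real \<Rightarrow> real" where
  "box_cox q r = (if q = 0 then ln r else (r powr q - 1) / q)"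

lemma box_cox_le:
  assumes "q \<le> 1" "0 \<le> r" "q \<le> 0 \<Longrightarrow> 0 < r"
  shows "box_cox q r \<le> r - 1"
proof -
  consider "q < 0" | "q = 0" | "0 < q" by linarith
  then show ?thesis
  proof cases
    case 1
    then show ?thesis
      using tangent_le_powr[of r q] assms by (simp add: box_cox_def field_simps)
  next
    case 2
    then show ?thesis using ln_le_minus_one[of r] assms by (simp add: box_cox_def)
  next
    case 3
    then show ?thesis
      using powr_le_tangent[of q r] assms by (simp add: box_cox_def field_simps)
  qed
qed

text \<open>The transform is compared with \<open>ln\<close>, which already has a quadratic lower
  bound. It dominates \<open>ln\<close> for \<open>q \<ge> 0\<close>; for \<open>q < 0\<close> it
  falls short by at most the second-order remainder of the exponential at
  \<open>q * ln r\<close>.\<close>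

lemma box_cox_ge_quadratic_near_one:
  fixes q r :: real
  assumes "1 / 2 \<le> r"
  shows "(r - 1) - (2 + 4 * \<bar>q\<bar> * 2 powr (- q)) * (r - 1)\<^sup>2 \<le> box_cox q r"
proof -
  have r: "0 < r" using assms by simp
  define K where "K = 4 * \<bar>q\<bar> * 2 powr (- q)"
  have K: "0 \<le> K" by (simp add: K_def)
  have ln: "(r - 1) - 2 * (r - 1)\<^sup>2 \<le> ln r" by (rule ln_ge_quadratic[OF assms])
  have "ln r \<le> box_cox q r + K * (r - 1)\<^sup>2"
  proof -
    consider "q = 0" | "0 < q" | "q < 0" by linarith
    then show ?thesis
    proof cases
      case 1
      then show ?thesis by (simp add: box_cox_def K_def)
    next
      case 2
      then have "ln r \<le> box_cox q r"
        using exp_ge_add_one_self[of "q * ln r"] r by (simp add: box_cox_def powr_def field_simps)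
      then show ?thesis using K by (smt (verit) mult_nonneg_nonneg zero_le_power2)
    next
      case 3
      \<comment> \<open>The remainder is at most \<open>(q * ln r)^2 * 2 powr (- q)\<close>, and
        \<open>(ln r)^2 \<le> 4 * (r - 1)^2\<close>. Dividing by the negative \<open>q\<close>
        reverses the inequality and removes one factor \<open>\<bar>q\<bar>\<close>, which leaves
        the constant \<open>K\<close>.\<close>
      have "r powr q \<le> (1 / 2) powr q" using 3 assms by (intro powr_mono2') auto
      also have h: "(1 / 2) powr q = 2 powr (- q)" by (simp add: powr_divide powr_minus_divide)
      finally have "max 1 (exp (q * ln r)) \<le> 2 powr (- q)"
        using 3 r ge_one_powr_ge_zero[of 2 "- q"] by (simp add: powr_def)
      then have "r powr q \<le> 1 + q * ln r + (q * ln r)\<^sup>2 * 2 powr (- q)"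
        using exp_le_quadratic[of "q * ln r"] r
          mult_left_mono[of "max 1 (exp (q * ln r))" "2 powr (- q)" "(q * ln r)\<^sup>2"]
        by (simp add: powr_def)
      moreover have "(ln r)\<^sup>2 \<le> 4 * (r - 1)\<^sup>2"
      proof -
        have "ln r \<le> r - 1" using ln_le_minus_one[OF r] .
        moreover have "- ln r \<le> 1 / r - 1" using ln_le_minus_one[of "1 / r"] r by (simp add: ln_div)
        moreover have "1 / r - 1 \<le> 2 * \<bar>r - 1\<bar>"
        proof -
          have "1 / r - 1 = (1 - r) / r" using r by (simp add: field_simps)
          also have "\<dots> \<le> \<bar>r - 1\<bar> / r" using r by (intro divide_right_mono) auto
          also have "\<dots> \<le> \<bar>r - 1\<bar> / (1 / 2)" using assms by (intro divide_left_mono) auto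
          finally show ?thesis by simp
        qed
        ultimately have "\<bar>ln r\<bar> \<le> \<bar>2 * (r - 1)\<bar>" by (smt (verit))
        then show ?thesis unfolding abs_le_square_iff power_mult_distrib by simp
      qed
      then have "q\<^sup>2 * (ln r)\<^sup>2 * 2 powr (- q) \<le> q\<^sup>2 * (4 * (r - 1)\<^sup>2) * 2 powr (- q)"
        by (intro mult_right_mono mult_left_mono) auto
      ultimately have "r powr q \<le> 1 + q * ln r - q * (K * (r - 1)\<^sup>2)"
        using 3 by (simp add: K_def power2_eq_square algebra_simps)
      then show ?thesis using 3 by (simp add: box_cox_def field_simps)
    qed
  qed
  with ln show ?thesis unfolding K_def by (simp add: algebra_simps)
qed

text \<open>For \<open>q > 0\<close> the transform never falls below \<open>- 1 / q\<close>. If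
  \<open>r < 1 / 2\<close>, then \<open>(r - 1)^2 \<ge> 1 / 4\<close>, so the additional coefficient
  \<open>4 / q\<close> absorbs this loss.\<close>

lemma box_cox_ge_quadratic_pos:
  fixes q r :: real
  assumes "0 < q" "0 \<le> r"
  shows "(r - 1) - (2 + 4 * \<bar>q\<bar> * 2 powr (- q) + 4 / q) * (r - 1)\<^sup>2 \<le> box_cox q r"
proof (cases "1 / 2 \<le> r")
  case True
  have "0 \<le> 4 / q * (r - 1)\<^sup>2" using assms by simp
  then show ?thesis using box_cox_ge_quadratic_near_one[OF True, of q]
    by (simp add: distrib_right)
next
  case False
  have "(1 / 2)\<^sup>2 \<le> (1 - r)\<^sup>2" using False by (intro power_mono) auto
  then have sq: "1 / 4 \<le> (r - 1)\<^sup>2" by (simp add: power2_commute[of r 1] power_divide)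
  have "1 / q \<le> 4 / q * (r - 1)\<^sup>2"
    using mult_left_mono[OF sq, of "4 / q"] assms by simp
  moreover have "0 \<le> (2 + 4 * \<bar>q\<bar> * 2 powr (- q)) * (r - 1)\<^sup>2" by simp
  moreover have "- (1 / q) \<le> box_cox q r" using assms by (simp add: box_cox_def field_simps)
  ultimately show ?thesis using False unfolding distrib_right by linarith
qed

section \<open>Hoelder means in ratio coordinates: homogeneity, expansion and supporting
  hyperplane\<close>

lemma holder_mean_nonneg: "(\<And>i. 0 \<le> B $ i) \<Longrightarrow> 0 \<le> holder_mean q B"
  by (simp add: holder_mean_def)

lemma holder_mean_scale:
  fixes B :: "real ^ 'n"
  assumes "0 < c" "\<And>i. 0 \<le> B $ i"
  shows "holder_mean q (c *\<^sub>R B) = c * holder_mean q B"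
proof (cases "q = 0")
  case True
  have "(\<Prod>i\<in>UNIV. c * B $ i) powr (1 / real CARD('n))
      = (c ^ CARD('n)) powr (1 / real CARD('n)) * (\<Prod>i\<in>UNIV. B $ i) powr (1 / real CARD('n))"
    using assms by (simp add: prod.distrib powr_mult prod_nonneg)
  also have "(c ^ CARD('n)) powr (1 / real CARD('n)) = c"
    using assms(1) by (simp add: powr_powr flip: powr_realpow)
  finally show ?thesis using True by (simp add: holder_mean_def)
next
  case False
  have "(1 / real CARD('n) * (\<Sum>i\<in>UNIV. (c * B $ i) powr q)) powr (1 / q)
      = (c powr q * (1 / real CARD('n) * (\<Sum>i\<in>UNIV. (B $ i) powr q))) powr (1 / q)"
    using assms by (simp add: powr_mult sum_distrib_left mult_ac)
  also have "\<dots> = (c powr q) powr (1 / q) * (1 / real CARD('n) * (\<Sum>i\<in>UNIV. (B $ i) powr q)) powr (1 / q)"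
    by (rule powr_mult)
  also have "(c powr q) powr (1 / q) = c" using False assms(1) by (simp add: powr_powr)
  finally show ?thesis using False assms(1) unfolding holder_mean_def by (simp add: zero_less_mult_iff)
qed

text \<open>For positive \<open>u\<close> this is the elasticity of \<open>holder_mean q\<close> in
  component \<open>i\<close>, so the gradient is
  \<open>holder_mean q u * share q u i / u $ i\<close>. Since \<open>0 powr q = 0\<close>, a
  vanishing component always has share 0.\<close>

definition share :: "real \<Rightarrow> real ^ 'n \<Rightarrow> 'n \<Rightarrow> real" where
  "share q u i = (u $ i) powr q / (\<Sum>j\<in>UNIV. (u $ j) powr q)"

text \<open>The domain on which \<open>B\<close> is recovered from its ratios to \<open>u\<close>:
  ratios \<open>0 / 0\<close> carry share 0, and for \<open>q \<le> 0\<close> no component may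
  vanish.\<close>

definition comparable :: "real \<Rightarrow> real ^ 'n \<Rightarrow> real ^ 'n \<Rightarrow> bool" where
  "comparable q u B \<longleftrightarrow> (\<forall>i. 0 \<le> u $ i \<and> 0 \<le> B $ i \<and> (u $ i = 0 \<longrightarrow> B $ i = 0) \<and>
     (q \<le> 0 \<longrightarrow> 0 < u $ i \<and> 0 < B $ i)) \<and> (\<exists>i. 0 < u $ i)"

lemma share_nonneg: "0 \<le> share q u i"
  unfolding share_def by (intro divide_nonneg_nonneg sum_nonneg) auto

lemma sum_powr_pos:
  fixes u :: "real ^ 'n"
  assumes "\<exists>i. 0 < u $ i"
  shows "0 < (\<Sum>j\<in>UNIV. (u $ j) powr q)"
proof -
  obtain i where "0 < u $ i" using assms by auto
  then show ?thesis by (intro sum_pos2[where i = i]) auto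
qed

lemma sum_share:
  fixes u :: "real ^ 'n"
  assumes "\<exists>i. 0 < u $ i"
  shows "(\<Sum>i\<in>UNIV. share q u i) = 1"
  using sum_powr_pos[OF assms, of q] by (simp add: share_def flip: sum_divide_distrib)

text \<open>Factoring out the sum of \<open>(u $ i) powr q\<close> leaves the share-weighted mean of
  the powers of the ratios, which is \<open>1 + q * G\<close>; for \<open>q = 0\<close> the same
  happens with logarithms. Hence the ratio of the two welfares depends only on the number
  \<open>G\<close>.\<close>

lemma holder_mean_ratio:
  fixes u B :: "real ^ 'n"
  assumes "comparable q u B"
  defines "G \<equiv> \<Sum>i\<in>UNIV. share q u i * box_cox q (B $ i / u $ i)"
  shows "q = 0 \<Longrightarrow> holder_mean q B = holder_mean q u * exp G"
    and "q \<noteq> 0 \<Longrightarrow> holder_mean q B = holder_mean q u * (1 + q * G) powr (1 / q)"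
    and "q \<noteq> 0 \<Longrightarrow> 0 \<le> 1 + q * G"
    and "q < 0 \<Longrightarrow> 0 < 1 + q * G"
proof -
  have c: "0 \<le> u $ i" "0 \<le> B $ i" "u $ i = 0 \<Longrightarrow> B $ i = 0" "q \<le> 0 \<Longrightarrow> 0 < u $ i"
    "q \<le> 0 \<Longrightarrow> 0 < B $ i" for i
    using assms(1) unfolding comparable_def by blast+
  have ex: "\<exists>i. 0 < u $ i" using assms(1) by (auto simp: comparable_def)
  note S = sum_powr_pos[OF ex, of q]
  {
    assume q: "q = 0"
    have geo: "(\<Prod>i\<in>UNIV. v $ i) powr (1 / real CARD('n)) = exp ((\<Sum>i\<in>UNIV. ln (v $ i)) / real CARD('n))"
      if "\<And>i. 0 < v $ i" for v :: "real ^ 'n"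
    proof -
      have "ln (\<Prod>i\<in>UNIV. v $ i) = (\<Sum>i\<in>UNIV. ln (v $ i))" 
        using that[THEN less_imp_neq, THEN not_sym] by (intro ln_prod) simp_all
      moreover have "(\<Prod>i\<in>UNIV. v $ i) > 0" using that by (intro prod_pos) auto
      then have "(\<Prod>i\<in>UNIV. v $ i) \<noteq> 0" by linarith
      ultimately show ?thesis unfolding powr_def by (simp del: prod_zero_iff)
    qed
    have "G = (\<Sum>i\<in>UNIV. (ln (B $ i) - ln (u $ i)) / real CARD('n))"
      unfolding G_def using c(4,5) q
      by (intro sum.cong) (auto simp: share_def box_cox_def ln_div less_imp_neq[THEN not_sym])
    then have "G = (\<Sum>i\<in>UNIV. ln (B $ i)) / real CARD('n) - (\<Sum>i\<in>UNIV. ln (u $ i)) / real CARD('n)"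
      by (simp add: sum_subtractf diff_divide_distrib sum_divide_distrib)
    then show "holder_mean q B = holder_mean q u * exp G"
      using q c(4,5) by (simp add: holder_mean_def geo exp_diff)
  }
  {
    assume q: "q \<noteq> 0"
    have "q * G = (\<Sum>i\<in>UNIV. share q u i * (B $ i / u $ i) powr q - share q u i)"
      unfolding G_def sum_distrib_left using q by (intro sum.cong) (auto simp: box_cox_def field_simps)
    then have eq: "1 + q * G = (\<Sum>i\<in>UNIV. share q u i * (B $ i / u $ i) powr q)"
      using sum_share[OF ex, of q] by (simp add: sum_subtractf)
    then show nn: "0 \<le> 1 + q * G" by (auto intro!: sum_nonneg mult_nonneg_nonneg share_nonneg)
    have "(\<Sum>i\<in>UNIV. (B $ i) powr q) = (\<Sum>j\<in>UNIV. (u $ j) powr q) * (1 + q * G)"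
      unfolding eq sum_distrib_left
    proof (rule sum.cong)
      fix i
      show "(B $ i) powr q = (\<Sum>j\<in>UNIV. (u $ j) powr q) * (share q u i * (B $ i / u $ i) powr q)"
        using S c(1-3)[of i] by (cases "u $ i = 0") (auto simp: share_def powr_divide)
    qed simp
    then have sumB: "1 / real CARD('n) * (\<Sum>i\<in>UNIV. (B $ i) powr q)
        = 1 / real CARD('n) * (\<Sum>j\<in>UNIV. (u $ j) powr q) * (1 + q * G)"
      by simp
    show "holder_mean q B = holder_mean q u * (1 + q * G) powr (1 / q)"
      using q c(4,5) unfolding holder_mean_def sumB powr_mult[of _ "1 + q * G"] by simp
    have "0 < 1 + q * G" if "q < 0"
    proof -
      have "0 < (\<Sum>j\<in>UNIV. (B $ j) powr q)"
        using c(5) that by (intro sum_powr_pos) auto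
      then show ?thesis using S sumB nn by (auto simp: less_le)
    qed
  }
  then show "q < 0 \<Longrightarrow> 0 < 1 + q * G" by auto
qed

text \<open>The welfare ratio is \<open>exp G\<close> or \<open>(1 + q * G) powr (1 / q)\<close>.
  For \<open>q \<le> 1\<close> both lie above their tangent \<open>1 + G\<close> at
  \<open>G = 0\<close>, as \<open>1 / q\<close> is either negative or at least 1.\<close>

lemma holder_mean_ge_box_cox:
  fixes u B :: "real ^ 'n"
  assumes "comparable q u B" "q \<le> 1"
  shows "holder_mean q u * (1 + (\<Sum>i\<in>UNIV. share q u i * box_cox q (B $ i / u $ i))) \<le> holder_mean q B"
proof -
  define G where "G = (\<Sum>i\<in>UNIV. share q u i * box_cox q (B $ i / u $ i))"
  note r = holder_mean_ratio[OF assms(1), folded G_def]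
  have M: "0 \<le> holder_mean q u" using assms(1) by (intro holder_mean_nonneg) (auto simp: comparable_def)
  show ?thesis
  proof (cases "q = 0")
    case True
    then show ?thesis using r(1) M exp_ge_add_one_self[of G]
      unfolding G_def[symmetric] by (simp add: mult_left_mono)
  next
    case False
    have "1 + G \<le> (1 + q * G) powr (1 / q)"
    \<comment> \<open>The tangent bound needs a positive base. At base 0 one has
      \<open>q > 0\<close> and \<open>q * (1 + G) = q - 1 \<le> 0\<close>, so the left side is not
      positive.\<close>
    proof (cases "1 + q * G = 0")
      case True
      then have "0 < q" using r(4) False by (cases "0 < q") auto
      have "q * (1 + G) \<le> 0" using True assms(2) by (simp add: algebra_simps)
      then have "1 + G \<le> 0" using \<open>0 < q\<close> by (simp add: mult_le_0_iff)
      with True show ?thesis by simp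
    next
      case ne: False
      then have "0 < 1 + q * G" using r(3) False by simp
      moreover have "1 / q \<le> 0 \<or> 1 \<le> 1 / q" using False assms(2) by (cases "0 < q") auto
      ultimately show ?thesis using tangent_le_powr[of "1 + q * G" "1 / q"] False by simp
    qed
    then show ?thesis using r(2)[OF False] M unfolding G_def[symmetric] by (simp add: mult_left_mono)
  qed
qed

lemma holder_mean_le_if_box_cox_nonpos:
  fixes u B :: "real ^ 'n"
  assumes "comparable q u B" "(\<Sum>i\<in>UNIV. share q u i * box_cox q (B $ i / u $ i)) \<le> 0"
  shows "holder_mean q B \<le> holder_mean q u"
proof -
  define G where "G = (\<Sum>i\<in>UNIV. share q u i * box_cox q (B $ i / u $ i))"
  note r = holder_mean_ratio[OF assms(1), folded G_def]
  have G: "G \<le> 0" using assms(2) by (simp add: G_def)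
  have M: "0 \<le> holder_mean q u" using assms(1) by (intro holder_mean_nonneg) (auto simp: comparable_def)
  consider "q = 0" | "0 < q" | "q < 0" by linarith
  then show ?thesis
  proof cases
    case 1
    then show ?thesis using r(1) M G by (simp add: mult_left_le)
  next
    case 2
    then have "(1 + q * G) powr (1 / q) \<le> 1"
      using r(3) G by (intro powr_le1) (auto simp: mult_le_0_iff)
    then show ?thesis using r(2) 2 M by (simp add: mult_left_le)
  next
    case 3
    then have "(1 + q * G) powr (1 / q) \<le> 1 powr (1 / q)"
      using G by (intro powr_mono2') (auto simp: mult_nonpos_nonpos)
    then show ?thesis using r(2) 3 M by (simp add: mult_left_le)
  qed
qed

text \<open>This is the supporting hyperplane at \<open>u\<close>, obtained without derivatives: by
  homogeneity the weighted mean of the ratios may be normalized to 1, and then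
  \<open>box_cox_le\<close> gives \<open>G \<le> 0\<close>.\<close>

lemma holder_mean_le_linear:
  fixes u B :: "real ^ 'n"
  assumes "\<And>i. 0 \<le> u $ i" "\<And>i. 0 \<le> B $ i" "\<And>i. u $ i = 0 \<Longrightarrow> B $ i = 0"
    and "\<And>i. q \<le> 0 \<Longrightarrow> 0 < u $ i" "\<exists>i. 0 < u $ i" "q \<le> 1"
  shows "holder_mean q B \<le> (\<Sum>i\<in>UNIV. holder_mean q u * share q u i / u $ i * B $ i)"
proof -
  have M: "0 \<le> holder_mean q u" using assms(1) by (rule holder_mean_nonneg)
  define a where "a = (\<Sum>i\<in>UNIV. share q u i * (B $ i / u $ i))"
  have rhs: "(\<Sum>i\<in>UNIV. holder_mean q u * share q u i / u $ i * B $ i) = holder_mean q u * a"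
    by (simp add: a_def sum_distrib_left mult_ac)
  have a0: "0 \<le> a" unfolding a_def using assms(1,2) by (intro sum_nonneg mult_nonneg_nonneg share_nonneg divide_nonneg_nonneg) auto
  \<comment> \<open>In the first two cases \<open>B\<close> has welfare 0, and the normalized vector
    could fail to be comparable or to exist.\<close>
  consider "q \<le> 0" "\<exists>i. B $ i = 0" | "B = 0" "q > 0" | "q \<le> 0 \<longrightarrow> (\<forall>i. 0 < B $ i)" "B \<noteq> 0"
    using assms(2) by (metis less_eq_real_def not_le zero_index)
  then show ?thesis
  proof cases
    case 1
    then obtain i where "B $ i = 0" by auto
    with 1 have "holder_mean q B = 0" by (auto simp: holder_mean_def dest: spec[of _ i])
    then show ?thesis unfolding rhs using M a0 by simp
  next
    case 2
    then show ?thesis by (simp add: holder_mean_def)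
  next
    case 3
    obtain i where i: "B $ i \<noteq> 0" using 3 by (auto simp: vec_eq_iff)
    then have "0 < share q u i * (B $ i / u $ i)"
      using assms(1-3)[of i] sum_powr_pos[OF assms(5), of q]
      by (auto simp: share_def less_le intro!: mult_pos_pos divide_pos_pos)
    then have a: "0 < a" unfolding a_def using assms(1,2)
      by (intro sum_pos2[where i = i] mult_nonneg_nonneg share_nonneg divide_nonneg_nonneg) auto
    define B' where "B' = (1 / a) *\<^sub>R B"
    have comp: "comparable q u B'" using assms 3 a by (auto simp: comparable_def B'_def)
    have "(\<Sum>i\<in>UNIV. share q u i * box_cox q (B' $ i / u $ i)) \<le> (\<Sum>i\<in>UNIV. share q u i * (B' $ i / u $ i - 1))"
      using comp assms(6) unfolding comparable_def
      by (intro sum_mono mult_left_mono box_cox_le share_nonneg) auto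
    also have "\<dots> = (\<Sum>i\<in>UNIV. share q u i * (B $ i / u $ i) / a) - (\<Sum>i\<in>UNIV. share q u i)"
      by (simp add: B'_def algebra_simps sum_subtractf)
    also have "\<dots> = 0" 
      unfolding sum_divide_distrib[symmetric] a_def[symmetric] using a sum_share[OF assms(5), of q] by simp
    finally have "holder_mean q B' \<le> holder_mean q u"
      using comp by (intro holder_mean_le_if_box_cox_nonpos)
    moreover have "holder_mean q B' = holder_mean q B / a"
      using holder_mean_scale[of "1 / a" B q] a assms(2) by (simp add: B'_def)
    ultimately show ?thesis unfolding rhs using a by (simp add: field_simps)
  qed
qed

section \<open>Fluid utilities and i.i.d. arrivals\<close>

text \<open>Additivity of the variance, by induction on the index set. The vanishing mean is carried
  along because it removes the cross term.\<close>

lemma expectation_Pi_pmf_centered_square: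
  fixes f :: "'a \<Rightarrow> real"
  assumes "finite A" "finite (set_pmf P)"
  defines "m \<equiv> measure_pmf.expectation P f"
  shows "measure_pmf.expectation (Pi_pmf A d (\<lambda>_. P)) (\<lambda>b. \<Sum>t\<in>A. f (b t) - m) = 0 \<and>
    measure_pmf.expectation (Pi_pmf A d (\<lambda>_. P)) (\<lambda>b. (\<Sum>t\<in>A. f (b t) - m)\<^sup>2)
      = real (card A) * measure_pmf.expectation P (\<lambda>x. (f x - m)\<^sup>2)"
  using assms(1)
proof (induction A rule: finite_induct)
  case empty
  then show ?case by simp
next
  case (insert a A)
  let ?Q = "Pi_pmf A d (\<lambda>_. P)"
  let ?E = "measure_pmf.expectation"
  have finQ: "finite (set_pmf ?Q)"
    using insert.hyps assms(2) by (simp add: set_Pi_pmf finite_PiE_dflt)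
  have intQ: "integrable (measure_pmf ?Q) g" for g :: "_ \<Rightarrow> real"
    by (rule integrable_measure_pmf_finite[OF finQ])
  have intP: "integrable (measure_pmf P) g" for g :: "_ \<Rightarrow> real"
    by (rule integrable_measure_pmf_finite[OF assms(2)])
  \<comment> \<open>Fubini for the coordinate \<open>a\<close>: draw its value \<open>y\<close>
    first, then the remaining coordinates independently.\<close>
  have split: "?E (Pi_pmf (insert a A) d (\<lambda>_. P)) h = ?E P (\<lambda>y. ?E ?Q (\<lambda>b. h (b(a := y))))"
    for h :: "_ \<Rightarrow> real"
  proof -
    have "Pi_pmf (insert a A) d (\<lambda>_. P) = P \<bind> (\<lambda>y. map_pmf (\<lambda>b. b(a := y)) ?Q)"
      using insert.hyps by (simp add: Pi_pmf_insert' map_pmf_def)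
    also have "?E \<dots> h = (\<Sum>y\<in>set_pmf P. pmf P y *\<^sub>R ?E (map_pmf (\<lambda>b. b(a := y)) ?Q) h)"
      using assms(2) finQ by (intro pmf_expectation_bind) auto
    also have "\<dots> = ?E P (\<lambda>y. ?E ?Q (\<lambda>b. h (b(a := y))))"
      using assms(2) by (subst integral_measure_pmf[where A = "set_pmf P"]) auto
    finally show ?thesis .
  qed
  define S where "S b = (\<Sum>t\<in>A. f (b t) - m)" for b
  have S_upd: "S (b(a := y)) = S b" for b y
    unfolding S_def using insert.hyps by (intro sum.cong) auto
  have sum_insert: "(\<Sum>t\<in>insert a A. f ((b(a := y)) t) - m) = (f y - m) + S b" for b y
    using insert.hyps S_upd[of b y] by (simp add: S_def)
  have S0: "?E ?Q S = 0" and S2: "?E ?Q (\<lambda>b. (S b)\<^sup>2) = real (card A) * ?E P (\<lambda>x. (f x - m)\<^sup>2)"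
    using insert.IH unfolding S_def by auto
  have P0: "?E P (\<lambda>y. f y - m) = 0"
    using intP[of f] by (simp add: m_def)
  have E1: "?E ?Q (\<lambda>b. (f y - m) + S b) = f y - m" for y
    using intQ S0 by simp
  have E2: "?E ?Q (\<lambda>b. ((f y - m) + S b)\<^sup>2) = (f y - m)\<^sup>2 + ?E ?Q (\<lambda>b. (S b)\<^sup>2)" for y
    using intQ S0 by (simp add: power2_sum)
  have "?E P (\<lambda>y. (f y - m)\<^sup>2 + ?E ?Q (\<lambda>b. (S b)\<^sup>2)) = ?E P (\<lambda>y. (f y - m)\<^sup>2) + ?E ?Q (\<lambda>b. (S b)\<^sup>2)"
    using intP by simp
  then show ?case
    unfolding split sum_insert E1 E2 using P0 S2 insert.hyps by (simp add: algebra_simps)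
qed

definition fluid_utility :: "(real ^ 'n) pmf \<Rightarrow> (real ^ 'n \<Rightarrow> real ^ 'n) \<Rightarrow> real ^ 'n" where
  "fluid_utility P \<xi> = (\<chi> i. \<Sum>\<beta>\<in>set_pmf P. pmf P \<beta> * \<beta> $ i * \<xi> \<beta> $ i)"

section \<open>Static policies and their expected utilities\<close>

lemma simplex_allocD:
  assumes "x \<in> simplex_alloc"
  shows "0 \<le> x $ i" "x $ i \<le> 1" "(\<Sum>i\<in>UNIV. x $ i) = 1"
proof -
  show nn: "0 \<le> x $ i" for i using assms by (simp add: simplex_alloc_def)
  show s: "(\<Sum>i\<in>UNIV. x $ i) = 1" using assms by (simp add: simplex_alloc_def)
  show "x $ i \<le> 1" using member_le_sum[of i UNIV "\<lambda>i. x $ i"] nn s by simp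
qed

lemma simplex_alloc_convex:
  assumes "x \<in> simplex_alloc" "y \<in> simplex_alloc" "0 \<le> e" "e \<le> 1"
  shows "(1 - e) *\<^sub>R x + e *\<^sub>R y \<in> simplex_alloc"
  using assms by (simp add: simplex_alloc_def sum.distrib flip: sum_distrib_left)

lemma axis_in_simplex_alloc: "axis i 1 \<in> simplex_alloc"
  by (simp add: simplex_alloc_def axis_def)

lemma uniform_in_simplex_alloc: "(\<chi> i. 1 / real CARD('n)) \<in> (simplex_alloc :: (real ^ 'n) set)"
  by (simp add: simplex_alloc_def)

lemma static_policyD:
  assumes "static_policy P \<xi>" "\<beta> \<in> set_pmf P"
  shows "0 \<le> \<xi> \<beta> $ i" "\<xi> \<beta> $ i \<le> 1"
  using assms by (auto simp: static_policy_def intro: simplex_allocD)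

lemma fluid_utility_mix:
  "fluid_utility P (\<lambda>\<beta>. (1 - e) *\<^sub>R \<xi> \<beta> + e *\<^sub>R \<xi>' \<beta>)
     = (1 - e) *\<^sub>R fluid_utility P \<xi> + e *\<^sub>R fluid_utility P \<xi>'"
  by (simp add: fluid_utility_def vec_eq_iff sum_distrib_left algebra_simps sum.distrib sum_subtractf)

lemma static_policy_mix:
  assumes "static_policy P \<xi>" "static_policy P \<xi>'" "0 \<le> e" "e \<le> 1"
  shows "static_policy P (\<lambda>\<beta>. (1 - e) *\<^sub>R \<xi> \<beta> + e *\<^sub>R \<xi>' \<beta>)"
  using assms by (simp add: static_policy_def simplex_alloc_convex)

context
  fixes P :: "(real ^ 'n) pmf"
  assumes adm: "admissible P"
begin

lemma atomD:
  assumes "\<beta> \<in> set_pmf P"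
  shows "0 \<le> \<beta> $ i" "\<beta> $ i \<le> 1"
  using assms adm by (auto simp: admissible_def)

lemma finite_atoms: "finite (set_pmf P)"
  using adm by (simp add: admissible_def)

lemma fluid_utility_expectation:
  "fluid_utility P \<xi> $ i = measure_pmf.expectation P (\<lambda>\<beta>. \<beta> $ i * \<xi> \<beta> $ i)"
  using finite_atoms
  by (subst integral_measure_pmf[where A = "set_pmf P"]) (auto simp: fluid_utility_def mult_ac)

lemma fluid_utility_nonneg: "static_policy P \<xi> \<Longrightarrow> 0 \<le> fluid_utility P \<xi> $ i"
  unfolding fluid_utility_def
  by (auto intro!: sum_nonneg mult_nonneg_nonneg simp: atomD static_policyD)

lemma fluid_utility_le_one:
  assumes "static_policy P \<xi>"
  shows "fluid_utility P \<xi> $ i \<le> 1"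
proof -
  have "fluid_utility P \<xi> $ i \<le> (\<Sum>\<beta>\<in>set_pmf P. pmf P \<beta>)"
    unfolding fluid_utility_def
    using assms by (auto intro!: sum_mono mult_left_le mult_le_one simp: atomD static_policyD mult.assoc)
  also have "\<dots> = 1" using finite_atoms by (intro sum_pmf_eq_1) auto
  finally show ?thesis .
qed

text \<open>Homogeneity extracts the factor \<open>T\<close>, so optimality is a condition without
  horizon. At \<open>T = 0\<close> all welfares are 0 and every static policy would be
  optimal.\<close>

lemma fluid_policy_iff:
  assumes "1 \<le> T"
  shows "fluid_policy P q T \<xi> \<longleftrightarrow> static_policy P \<xi> \<and>
    (\<forall>\<xi>'. static_policy P \<xi>' \<longrightarrow> holder_mean q (fluid_utility P \<xi>') \<le> holder_mean q (fluid_utility P \<xi>))"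
proof -
  have "fluid_value P q T \<xi> = real T * holder_mean q (fluid_utility P \<xi>)" if "static_policy P \<xi>" for \<xi>
  proof -
    have "fluid_value P q T \<xi> = holder_mean q (real T *\<^sub>R fluid_utility P \<xi>)"
      by (simp add: fluid_value_def fluid_utility_def scaleR_vec_def)
    also have "\<dots> = real T * holder_mean q (fluid_utility P \<xi>)"
      using assms fluid_utility_nonneg[OF that] by (intro holder_mean_scale) auto
    finally show ?thesis .
  qed
  then show ?thesis using assms by (auto simp: fluid_policy_def)
qed

lemma set_arrivalsD: "b \<in> set_pmf (arrivals P T) \<Longrightarrow> t \<in> {1..T} \<Longrightarrow> b t \<in> set_pmf P"
  unfolding arrivals_def by (subst (asm) set_Pi_pmf) (auto simp: PiE_dflt_def)

lemma integrable_arrivals: "integrable (measure_pmf (arrivals P T)) (f :: _ \<Rightarrow> real)"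
  unfolding arrivals_def using finite_atoms
  by (intro integrable_measure_pmf_finite) (simp add: set_Pi_pmf finite_PiE_dflt)

lemma expectation_mono_arrivals:
  fixes f g :: "_ \<Rightarrow> real"
  assumes "\<And>b. (\<And>t. t \<in> {1..T} \<Longrightarrow> b t \<in> set_pmf P) \<Longrightarrow> f b \<le> g b"
  shows "measure_pmf.expectation (arrivals P T) f \<le> measure_pmf.expectation (arrivals P T) g"
  using assms set_arrivalsD
  by (intro integral_mono_AE integrable_arrivals) (auto simp: AE_measure_pmf_iff)

text \<open>The variance of a \<open>[0,1]\<close>-valued variable is at most its mean.\<close>

lemma expectation_deviation_sq:
  assumes "static_policy P \<xi>"
  shows "measure_pmf.expectation (arrivals P T)
      (\<lambda>b. (cum_utility T b (\<lambda>t. \<xi> (b t)) $ i - real T * fluid_utility P \<xi> $ i)\<^sup>2)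
    \<le> real T * fluid_utility P \<xi> $ i"
proof -
  let ?E = "measure_pmf.expectation"
  define f where "f \<beta> = \<beta> $ i * \<xi> \<beta> $ i" for \<beta> :: "real ^ 'n"
  define m where "m = ?E P f"
  have int: "integrable (measure_pmf P) g" for g :: "_ \<Rightarrow> real"
    by (rule integrable_measure_pmf_finite[OF finite_atoms])
  have m: "fluid_utility P \<xi> $ i = m" by (simp add: fluid_utility_expectation f_def[abs_def] m_def)
  have "cum_utility T b (\<lambda>t. \<xi> (b t)) $ i - real T * m = (\<Sum>t\<in>{1..T}. f (b t) - m)" for b
    by (simp add: cum_utility_def f_def sum_subtractf)
  then have "?E (arrivals P T) (\<lambda>b. (cum_utility T b (\<lambda>t. \<xi> (b t)) $ i - real T * m)\<^sup>2)
      = real T * ?E P (\<lambda>x. (f x - m)\<^sup>2)"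
    using expectation_Pi_pmf_centered_square[of "{1..T}" P 0 f] finite_atoms
    by (simp add: arrivals_def m_def)
  also have "?E P (\<lambda>x. (f x - m)\<^sup>2) \<le> m"
  proof -
    have "?E P (\<lambda>x. (f x - m)\<^sup>2) = ?E P (\<lambda>x. (f x)\<^sup>2) - m\<^sup>2"
      using int by (simp add: power2_diff flip: m_def) (simp add: power2_eq_square)
    also have "\<dots> \<le> ?E P (\<lambda>x. (f x)\<^sup>2)" by simp
    also have "\<dots> \<le> m" unfolding m_def
    proof (intro integral_mono_AE int, unfold AE_measure_pmf_iff, intro ballI)
      fix \<beta> assume b: "\<beta> \<in> set_pmf P"
      then have "0 \<le> f \<beta>" "f \<beta> \<le> 1"
        unfolding f_def using atomD[OF b] static_policyD[OF assms b] by (auto intro!: mult_le_one)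
      then show "(f \<beta>)\<^sup>2 \<le> f \<beta>" by (simp add: power2_eq_square mult_left_le)
    qed
    finally show ?thesis .
  qed
  finally show ?thesis unfolding m by (simp add: mult_left_mono)
qed

end

section \<open>Second-order bounds and maximizers of the welfare\<close>

text \<open>
  The quadratic bound is a Taylor estimate when all ratios are at least \<open>1/2\<close>. The term \<open>4 / \<bar>q\<bar>\<close>
  (\<open>0\<close> for \<open>q = 0\<close>) covers small ratios for \<open>q > 0\<close>. For \<open>q \<le> 0\<close> the welfare collapses when a single ratio is
  small; \<open>6 * D\<close> covers this, as all shares are then at least \<open>1 / D\<close>.
\<close>

definition gap_const :: "real \<Rightarrow> real \<Rightarrow> real" where
  "gap_const q D = 3 + 4 * \<bar>q\<bar> * 2 powr (- q) + 4 / \<bar>q\<bar> + 6 * D"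

text \<open>If \<open>q > 0\<close> or all ratios are at least \<open>1 / 2\<close>, the quadratic
  bounds on \<open>box_cox\<close> are averaged with the shares. Otherwise the welfare of
  \<open>B\<close> is only bounded below by 0, and the quadratic term alone must dominate the linear
  one.\<close>

lemma holder_mean_gap_le:
  fixes u B :: "real ^ 'n"
  assumes u: "\<And>i. 0 \<le> u $ i" and B: "\<And>i. 0 \<le> B $ i" and uB: "\<And>i. u $ i = 0 \<Longrightarrow> B $ i = 0"
    and upos: "\<And>i. q \<le> 0 \<Longrightarrow> 0 < u $ i" and ex: "\<exists>i. 0 < u $ i" and "q \<le> 1"
    and D: "0 \<le> D" "\<And>i. q \<le> 0 \<Longrightarrow> 1 \<le> D * share q u i"
  shows "holder_mean q u * (\<Sum>i\<in>UNIV. share q u i * (B $ i / u $ i)) - holder_mean q B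
    \<le> holder_mean q u * (gap_const q D * (\<Sum>i\<in>UNIV. share q u i * (B $ i / u $ i - 1)\<^sup>2))"
proof -
  define r where "r i = B $ i / u $ i" for i
  define K where "K = gap_const q D"
  define \<sigma> where "\<sigma> = (\<Sum>i\<in>UNIV. share q u i * (r i - 1)\<^sup>2)"
  have M: "0 \<le> holder_mean q u" using u by (rule holder_mean_nonneg)
  have r0: "0 \<le> r i" for i using u B by (simp add: r_def)
  have \<sigma>: "0 \<le> \<sigma>" unfolding \<sigma>_def by (intro sum_nonneg mult_nonneg_nonneg share_nonneg) auto
  have share_mean: "(\<Sum>i\<in>UNIV. share q u i * (r i - 1)) = (\<Sum>i\<in>UNIV. share q u i * r i) - 1"
    using sum_share[OF ex, of q] by (simp add: right_diff_distrib sum_subtractf)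
  have "holder_mean q u * (\<Sum>i\<in>UNIV. share q u i * r i) - holder_mean q B \<le> holder_mean q u * (K * \<sigma>)"
  proof (cases "0 < q \<or> (\<forall>i. 1 / 2 \<le> r i)")
    case True
    have "comparable q u B"
      unfolding comparable_def
    proof (intro conjI allI impI u B uB upos ex)
      fix i assume "q \<le> 0"
      with True have "1 / 2 \<le> r i" by auto
      then show "0 < B $ i" using B[of i] by (auto simp: r_def less_le)
    qed
    note ge = holder_mean_ge_box_cox[OF this \<open>q \<le> 1\<close>, folded r_def]
    have "(r i - 1) - K * (r i - 1)\<^sup>2 \<le> box_cox q (r i)" for i
    proof (cases "0 < q")
      case pos: True
      have "(2 + 4 * \<bar>q\<bar> * 2 powr (- q) + 4 / q) * (r i - 1)\<^sup>2 \<le> K * (r i - 1)\<^sup>2"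
        using D(1) pos by (intro mult_right_mono) (auto simp: K_def gap_const_def)
      then show ?thesis using box_cox_ge_quadratic_pos[OF pos r0[of i]] by linarith
    next
      case False
      then have "1 / 2 \<le> r i" using True by auto
      moreover have "(2 + 4 * \<bar>q\<bar> * 2 powr (- q)) * (r i - 1)\<^sup>2 \<le> K * (r i - 1)\<^sup>2"
        using D(1) by (intro mult_right_mono) (auto simp: K_def gap_const_def)
      ultimately show ?thesis using box_cox_ge_quadratic_near_one[of "r i" q] by linarith
    qed
    then have "(\<Sum>i\<in>UNIV. share q u i * ((r i - 1) - K * (r i - 1)\<^sup>2)) \<le> (\<Sum>i\<in>UNIV. share q u i * box_cox q (r i))"
      by (intro sum_mono mult_left_mono share_nonneg)
    moreover have "(\<Sum>i\<in>UNIV. share q u i * ((r i - 1) - K * (r i - 1)\<^sup>2)) = (\<Sum>i\<in>UNIV. share q u i * r i) - 1 - K * \<sigma>"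
      unfolding share_mean[symmetric] \<sigma>_def by (simp add: algebra_simps sum_subtractf sum.distrib sum_distrib_left)
    ultimately have "holder_mean q u * ((\<Sum>i\<in>UNIV. share q u i * r i) - K * \<sigma>)
        \<le> holder_mean q u * (1 + (\<Sum>i\<in>UNIV. share q u i * box_cox q (r i)))"
      using M by (intro mult_left_mono) auto
    with ge show ?thesis by (simp add: algebra_simps)
  next
    case False
    then obtain i where i: "r i < 1 / 2" and q: "q \<le> 0" by (auto simp: not_le not_less)
    \<comment> \<open>One ratio below \<open>1 / 2\<close> with share at least \<open>1 / D\<close>
      already forces \<open>D * \<sigma> \<ge> 1 / 4\<close>.\<close>
    have "(1 / 2)\<^sup>2 \<le> (1 - r i)\<^sup>2" using i by (intro power_mono) auto
    then have "1 / 4 \<le> (r i - 1)\<^sup>2" by (simp add: power2_commute[of "r i" 1] power_divide)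
    then have "share q u i * (1 / 4) \<le> share q u i * (r i - 1)\<^sup>2"
      by (intro mult_left_mono share_nonneg)
    also have "\<dots> \<le> \<sigma>" unfolding \<sigma>_def
      by (intro member_le_sum mult_nonneg_nonneg share_nonneg) auto
    finally have "D * (share q u i * (1 / 4)) \<le> D * \<sigma>" using D(1) by (intro mult_left_mono)
    then have D\<sigma>: "1 / 4 \<le> D * \<sigma>" using D(2)[OF q, of i] by simp
    \<comment> \<open>The arithmetic-geometric inequality bounds the mean ratio by
      \<open>3 / 2 + \<sigma> / 2\<close>; the constant \<open>3 / 2\<close> is at most
      \<open>6 * D * \<sigma>\<close>.\<close>
    have "(\<Sum>i\<in>UNIV. share q u i * (r i - 1)) \<le> (\<Sum>i\<in>UNIV. share q u i * ((1 + (r i - 1)\<^sup>2) / 2))"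
    proof (intro sum_mono mult_left_mono share_nonneg)
      fix i
      show "r i - 1 \<le> (1 + (r i - 1)\<^sup>2) / 2"
        using zero_le_power2[of "r i - 2"] by (simp add: power2_eq_square algebra_simps)
    qed
    also have "\<dots> = (\<Sum>i\<in>UNIV. share q u i) / 2 + \<sigma> / 2"
      by (simp add: \<sigma>_def sum_divide_distrib sum.distrib algebra_simps add_divide_distrib)
    finally have "(\<Sum>i\<in>UNIV. share q u i * r i) \<le> 3 / 2 + \<sigma> / 2"
      using share_mean sum_share[OF ex, of q] by simp
    also have "\<dots> \<le> (3 + 6 * D) * \<sigma>" using D\<sigma> \<sigma> by (simp add: algebra_simps)
    also have "\<dots> \<le> K * \<sigma>" using \<sigma> by (intro mult_right_mono) (auto simp: K_def gap_const_def)
    finally have "holder_mean q u * (\<Sum>i\<in>UNIV. share q u i * r i) \<le> holder_mean q u * (K * \<sigma>)"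
      using M by (intro mult_left_mono)
    then show ?thesis using holder_mean_nonneg[of B q] B by simp
  qed
  then show ?thesis by (simp add: r_def K_def \<sigma>_def)
qed

text \<open>The gap bound replaces differentiation along the segment: the welfare at
  \<open>(1 - e) *\<^sub>R u + e *\<^sub>R v\<close> is at least
  \<open>holder_mean q u * (1 + e * L - e^2 * V)\<close>. A positive slope \<open>L\<close> would
  contradict optimality for small \<open>e\<close>.\<close>

lemma holder_mean_first_order:
  fixes u v :: "real ^ 'n"
  assumes u: "\<And>i. 0 \<le> u $ i" and v: "\<And>i. 0 \<le> v $ i" and uv: "\<And>i. u $ i = 0 \<Longrightarrow> v $ i = 0"
    and upos: "\<And>i. q \<le> 0 \<Longrightarrow> 0 < u $ i" and ex: "\<exists>i. 0 < u $ i" and "q \<le> 1"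
    and D: "0 \<le> D" "\<And>i. q \<le> 0 \<Longrightarrow> 1 \<le> D * share q u i"
    and M: "0 < holder_mean q u"
    and opt: "\<And>e. 0 < e \<Longrightarrow> e \<le> 1 \<Longrightarrow> holder_mean q ((1 - e) *\<^sub>R u + e *\<^sub>R v) \<le> holder_mean q u"
  shows "(\<Sum>i\<in>UNIV. share q u i * (v $ i / u $ i)) \<le> 1"
proof (rule ccontr)
  define L where "L = (\<Sum>i\<in>UNIV. share q u i * (v $ i / u $ i - 1))"
  define V where "V = gap_const q D * (\<Sum>i\<in>UNIV. share q u i * (v $ i / u $ i - 1)\<^sup>2)"
  have L_eq: "L = (\<Sum>i\<in>UNIV. share q u i * (v $ i / u $ i)) - 1"
    unfolding L_def using sum_share[OF ex, of q] by (simp add: right_diff_distrib sum_subtractf)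
  have share0: "share q u i = 0" if "u $ i = 0" for i using that by (simp add: share_def)
  assume "\<not> ?thesis"
  then have L: "0 < L" by (simp add: L_eq)
  have V: "0 \<le> V" unfolding V_def gap_const_def
    using D(1) by (intro mult_nonneg_nonneg sum_nonneg share_nonneg add_nonneg_nonneg) auto
  \<comment> \<open>Small enough for \<open>e * V < L\<close>; the \<open>+ 1\<close> keeps the
    quotient meaningful when \<open>V = 0\<close>.\<close>
  define e where "e = min 1 (L / (V + 1))"
  have e: "0 < e" "e \<le> 1" using L V by (auto simp: e_def)
  define B where "B = (1 - e) *\<^sub>R u + e *\<^sub>R v"
  have r: "share q u i * (B $ i / u $ i) = share q u i + e * (share q u i * (v $ i / u $ i - 1))" for i
    using share0[of i] by (cases "u $ i = 0") (auto simp: B_def field_simps)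
  have sq: "share q u i * (B $ i / u $ i - 1)\<^sup>2 = e\<^sup>2 * (share q u i * (v $ i / u $ i - 1)\<^sup>2)" for i
  proof (cases "u $ i = 0")
    case False
    then have "B $ i / u $ i - 1 = e * (v $ i / u $ i - 1)" by (simp add: B_def field_simps)
    then show ?thesis by (simp add: power_mult_distrib)
  qed (simp add: share0)
  have "holder_mean q u * (\<Sum>i\<in>UNIV. share q u i * (B $ i / u $ i)) - holder_mean q B
      \<le> holder_mean q u * (gap_const q D * (\<Sum>i\<in>UNIV. share q u i * (B $ i / u $ i - 1)\<^sup>2))"
    using u v e by (intro holder_mean_gap_le upos ex assms(6) D) (auto simp: B_def uv)
  also have "gap_const q D * (\<Sum>i\<in>UNIV. share q u i * (B $ i / u $ i - 1)\<^sup>2) = e\<^sup>2 * V"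
    unfolding sq V_def by (simp flip: sum_distrib_left)
  also have "(\<Sum>i\<in>UNIV. share q u i * (B $ i / u $ i)) = 1 + e * L"
    unfolding r L_def using sum_share[OF ex, of q] by (simp add: sum.distrib flip: sum_distrib_left)
  finally have "holder_mean q u * (1 + e * L) \<le> holder_mean q u * (1 + e\<^sup>2 * V)"
    using opt[OF e] by (simp add: B_def algebra_simps)
  then have "e * L \<le> e * (e * V)" using M by (simp add: power2_eq_square)
  then have "L \<le> e * V" using e by simp
  also have "\<dots> \<le> L / (V + 1) * V" using V by (intro mult_right_mono) (auto simp: e_def)
  also have "\<dots> < L" using L V by (simp add: field_simps)
  finally show False by simp
qed

text \<open>The supporting hyperplane at the all-ones vector is the arithmetic mean.\<close>

lemma holder_mean_le_one:
  fixes u :: "real ^ 'n"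
  assumes "\<And>i. 0 \<le> u $ i" "\<And>i. u $ i \<le> 1" "q \<le> 1"
  shows "holder_mean q u \<le> 1"
proof -
  define o1 :: "real ^ 'n" where "o1 = (\<chi> i. 1)"
  have "holder_mean q o1 = 1" by (simp add: holder_mean_def o1_def)
  then have "holder_mean q u \<le> (\<Sum>i\<in>UNIV. 1 / real CARD('n) * u $ i)"
    using holder_mean_le_linear[of o1 u q] assms by (simp add: o1_def share_def)
  also have "\<dots> \<le> (\<Sum>i::'n\<in>UNIV. 1 / real CARD('n) * 1)"
    using assms by (intro sum_mono mult_left_mono) auto
  finally show ?thesis by simp
qed

section \<open>Positivity of maximizers and comparison of power sums\<close>

lemma holder_mean_pos:
  fixes u :: "real ^ 'n"
  assumes "\<And>i. 0 \<le> u $ i" "\<exists>i. 0 < u $ i" "\<And>i. q \<le> 0 \<Longrightarrow> 0 < u $ i"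
  shows "0 < holder_mean q u"
proof (cases "q = 0")
  case True
  then have "(\<Prod>i\<in>UNIV. u $ i) > 0" using assms(3) by (intro prod_pos) auto
  then show ?thesis using True unfolding holder_mean_def by (simp del: prod_zero_iff)
next
  case False
  then show ?thesis using sum_powr_pos[OF assms(2), of q] assms(3) by (auto simp: holder_mean_def)
qed

lemma holder_mean_pos_imp_pos:
  fixes u :: "real ^ 'n"
  assumes "\<And>i. 0 \<le> u $ i" "q \<le> 0" "0 < holder_mean q u"
  shows "0 < u $ i"
proof (rule ccontr)
  assume "\<not> 0 < u $ i"
  then have "u $ i = 0" using assms(1)[of i] by simp
  with assms(2) have "holder_mean q u = 0" by (auto simp: holder_mean_def dest: spec[of _ i])
  with assms(3) show False by simp
qed

lemma holder_mean_le_imp_sum_powr_le: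
  fixes u v :: "real ^ 'n"
  assumes "0 < q" "holder_mean q v \<le> holder_mean q u"
  shows "(\<Sum>i\<in>UNIV. (v $ i) powr q) \<le> (\<Sum>i\<in>UNIV. (u $ i) powr q)"
proof (rule ccontr)
  assume "\<not> ?thesis"
  then have "(1 / real CARD('n) * (\<Sum>i\<in>UNIV. (u $ i) powr q)) powr (1 / q)
      < (1 / real CARD('n) * (\<Sum>i\<in>UNIV. (v $ i) powr q)) powr (1 / q)"
    using assms(1) by (intro powr_less_mono2 mult_strict_left_mono mult_nonneg_nonneg sum_nonneg) auto
  with assms show False by (simp add: holder_mean_def)
qed

text \<open>For \<open>q < 0\<close> the outer power \<open>1 / q\<close> is decreasing, so larger
  welfare means a smaller power sum; at \<open>q = 0\<close> both sums count the agents. Optimality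
  thus bounds the power sum of a maximizer by that of any positive competitor.\<close>

lemma holder_mean_le_imp_sum_powr_ge:
  fixes u v :: "real ^ 'n"
  assumes "q \<le> 0" "holder_mean q v \<le> holder_mean q u" "\<And>i. 0 < u $ i" "\<And>i. 0 < v $ i"
  shows "(\<Sum>i\<in>UNIV. (u $ i) powr q) \<le> (\<Sum>i\<in>UNIV. (v $ i) powr q)"
proof (cases "q = 0")
  case True
  then show ?thesis using assms(3,4) by (simp add: less_imp_neq[THEN not_sym])
next
  case False
  then have q: "q < 0" using assms(1) by simp
  show ?thesis
  proof (rule ccontr)
    assume "\<not> ?thesis"
    moreover have "0 < (\<Sum>i\<in>UNIV. (v $ i) powr q)" using assms(4) by (intro sum_powr_pos) auto
    ultimately have "(1 / real CARD('n) * (\<Sum>i\<in>UNIV. (u $ i) powr q)) powr (1 / q)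
        < (1 / real CARD('n) * (\<Sum>i\<in>UNIV. (v $ i) powr q)) powr (1 / q)"
      using q by (intro powr_less_mono2_neg mult_strict_left_mono mult_pos_pos) auto
    with assms q show False by (simp add: holder_mean_def)
  qed
qed

text \<open>The slope of \<open>x powr q\<close> is infinite at \<open>0\<close>, so a maximizer does not starve an agent who can be served.\<close>

lemma holder_mean_maximizer_pos:
  fixes u v :: "real ^ 'n"
  assumes "0 < q" "q < 1" "\<And>i. 0 \<le> u $ i" "\<And>i. 0 \<le> v $ i" "0 < v $ i" "v $ i \<le> 1"
    and opt: "\<And>e. 0 < e \<Longrightarrow> e \<le> 1 \<Longrightarrow> holder_mean q ((1 - e) *\<^sub>R u + e *\<^sub>R v) \<le> holder_mean q u"
  shows "0 < u $ i"
proof (rule ccontr)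
  assume "\<not> 0 < u $ i"
  then have ui: "u $ i = 0" using assms(3)[of i] by simp
  define S where "S = (\<Sum>j\<in>UNIV. (u $ j) powr q)"
  have S: "0 \<le> S" unfolding S_def by (intro sum_nonneg) auto
  have vi: "0 < (v $ i) powr q" "(v $ i) powr q \<le> 1" using assms by (auto intro!: powr_le1)
  \<comment> \<open>With \<open>e powr (1 - q) = c\<close> the loss \<open>e * S\<close> of the
    other agents equals \<open>e powr q * c * S\<close>. The choice of \<open>c\<close> makes this
    smaller than the gain \<open>e powr q * (v $ i) powr q\<close> of agent
    \<open>i\<close>.\<close>
  define c where "c = (v $ i) powr q / (S + 1)"
  have c: "0 < c" "c \<le> 1" using vi S by (auto simp: c_def)
  define e where "e = c powr (1 / (1 - q))"
  have e: "0 < e" "e \<le> 1" using c assms by (auto simp: e_def intro!: powr_le1)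
  have c_eq: "e powr (1 - q) = c" using c assms by (simp add: e_def powr_powr)
  have eq: "e = c * e powr q" unfolding c_eq[symmetric] powr_add[symmetric] using e by simp
  have "(1 - e) * S + e powr q * (v $ i) powr q
      = (\<Sum>j\<in>UNIV. (1 - e) * (u $ j) powr q + (if j = i then e powr q * (v $ i) powr q else 0))"
    by (simp add: S_def sum.distrib sum_distrib_left)
  also have "\<dots> \<le> (\<Sum>j\<in>UNIV. (((1 - e) *\<^sub>R u + e *\<^sub>R v) $ j) powr q)"
  proof (intro sum_mono)
    fix j
    show "(1 - e) * (u $ j) powr q + (if j = i then e powr q * (v $ i) powr q else 0)
        \<le> (((1 - e) *\<^sub>R u + e *\<^sub>R v) $ j) powr q"
    proof (cases "j = i")
      case True
      then show ?thesis using ui assms(1,5) e by (simp add: powr_mult)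
    next
      case False
      have "1 - e \<le> (1 - e) powr q"
      proof (cases "e = 1")
        case False
        then have "(1 - e) powr 1 \<le> (1 - e) powr q" using e assms by (intro powr_mono') auto
        then show ?thesis using e by simp
      qed simp
      then have "(1 - e) * (u $ j) powr q \<le> (1 - e) powr q * (u $ j) powr q"
        by (intro mult_right_mono) auto
      also have "\<dots> = ((1 - e) * u $ j) powr q" by (simp add: powr_mult)
      also have "\<dots> \<le> (((1 - e) *\<^sub>R u + e *\<^sub>R v) $ j) powr q"
        using assms e by (intro powr_mono2) auto
      finally show ?thesis using False by simp
    qed
  qed
  also have "\<dots> \<le> S" unfolding S_def using opt[OF e] assms(1) by (intro holder_mean_le_imp_sum_powr_le)
  finally have "e powr q * (v $ i) powr q \<le> e * S" by (simp add: algebra_simps)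
  also have "\<dots> = e powr q * (c * S)" using eq by (metis mult.assoc mult.commute)
  finally have "(v $ i) powr q \<le> c * S" using e by simp
  also have "\<dots> < (v $ i) powr q" using S vi by (simp add: c_def field_simps)
  finally show False by simp
qed

section \<open>Prices and the regret\<close>

lemma holder_mean_1:
  assumes "\<And>i. 0 \<le> B $ i"
  shows "holder_mean 1 B = (\<Sum>i\<in>UNIV. 1 / real CARD('n) * (B :: real ^ 'n) $ i)"
  using assms by (simp add: holder_mean_def sum_nonneg sum_divide_distrib)

lemma fluid_utility_eq_0:
  assumes "\<And>\<beta>. \<beta> \<in> set_pmf P \<Longrightarrow> \<beta> $ i = 0"
  shows "fluid_utility P \<xi> $ i = 0"
  using assms by (simp add: fluid_utility_def)

context
  fixes P :: "(real ^ 'n) pmf"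
  assumes adm: "admissible P"
begin

text \<open>
  Agents whose utility vanishes on every atom get no utility from any policy, so \<open>B\<close> is restricted
  accordingly; this permits price \<open>0\<close> for them, where the gradient of the welfare may be infinite.
\<close>

definition price_vector :: "real \<Rightarrow> (real ^ 'n \<Rightarrow> real ^ 'n) \<Rightarrow> ('n \<Rightarrow> real) \<Rightarrow> bool" where
  "price_vector q \<xi> g \<longleftrightarrow>
     (\<forall>B. (\<forall>i. 0 \<le> B $ i \<and> ((\<forall>\<beta>\<in>set_pmf P. \<beta> $ i = 0) \<longrightarrow> B $ i = 0)) \<longrightarrow>
        holder_mean q B \<le> (\<Sum>i\<in>UNIV. g i * B $ i)) \<and>
     (\<forall>\<xi>'. static_policy P \<xi>' \<longrightarrow>
        (\<Sum>i\<in>UNIV. g i * fluid_utility P \<xi>' $ i) \<le> (\<Sum>i\<in>UNIV. g i * fluid_utility P \<xi> $ i))"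

text \<open>The expected linear value separates over the atoms. Changing the policy at
  \<open>\<beta>0\<close> alone affects a single term, whose probability is positive.\<close>

lemma price_vector_argmax:
  assumes "static_policy P \<xi>" "price_vector q \<xi> g" "\<beta>0 \<in> set_pmf P" "x \<in> simplex_alloc"
  shows "(\<Sum>i\<in>UNIV. g i * (\<beta>0 $ i * x $ i)) \<le> (\<Sum>i\<in>UNIV. g i * (\<beta>0 $ i * \<xi> \<beta>0 $ i))"
proof -
  let ?G = "\<lambda>\<xi> \<beta>. \<Sum>i\<in>UNIV. g i * (\<beta> $ i * \<xi> \<beta> $ i)"
  have lin: "(\<Sum>i\<in>UNIV. g i * fluid_utility P \<xi> $ i) = (\<Sum>\<beta>\<in>set_pmf P. pmf P \<beta> * ?G \<xi> \<beta>)" for \<xi>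
    unfolding fluid_utility_def by (simp add: sum_distrib_left mult_ac) (rule sum.swap)
  have "static_policy P (\<xi>(\<beta>0 := x))" using assms by (simp add: static_policy_def)
  then have "(\<Sum>\<beta>\<in>set_pmf P. pmf P \<beta> * ?G (\<xi>(\<beta>0 := x)) \<beta>) \<le> (\<Sum>\<beta>\<in>set_pmf P. pmf P \<beta> * ?G \<xi> \<beta>)"
    using assms(2) unfolding lin[symmetric] price_vector_def by blast
  moreover have "(\<Sum>\<beta>\<in>set_pmf P - {\<beta>0}. pmf P \<beta> * ?G (\<xi>(\<beta>0 := x)) \<beta>) = (\<Sum>\<beta>\<in>set_pmf P - {\<beta>0}. pmf P \<beta> * ?G \<xi> \<beta>)"
    by (intro sum.cong) auto
  ultimately have "pmf P \<beta>0 * ?G (\<xi>(\<beta>0 := x)) \<beta>0 \<le> pmf P \<beta>0 * ?G \<xi> \<beta>0"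
    using finite_atoms[OF adm] assms(3) by (simp add: sum.remove)
  moreover have "0 < pmf P \<beta>0" using assms(3) by (rule pmf_positive)
  ultimately show ?thesis by simp
qed

text \<open>For the lower bound, the static policy is one of the feasible allocations. For the upper
  bound, the prices dominate the welfare, and \<open>\<xi> (b t)\<close> maximizes the priced
  utility in each period separately; this also makes the supremum bounded.\<close>

lemma hindsight_gap:
  assumes xi: "static_policy P \<xi>" and g: "price_vector q \<xi> g"
    and b: "\<And>t. t \<in> {1..T} \<Longrightarrow> b t \<in> set_pmf P"
  shows "static_welfare q T \<xi> b \<le> hindsight_opt q T b"
    and "hindsight_opt q T b \<le> (\<Sum>i\<in>UNIV. g i * cum_utility T b (\<lambda>t. \<xi> (b t)) $ i)"
proof -
  let ?X = "{x. \<forall>t\<in>{1..T}. x t \<in> simplex_alloc}"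
  let ?G = "\<lambda>x. \<Sum>i\<in>UNIV. g i * cum_utility T b x $ i"
  have lin: "?G x = (\<Sum>t = 1..T. \<Sum>i\<in>UNIV. g i * (b t $ i * x t $ i))" for x
    unfolding cum_utility_def by (simp add: sum_distrib_left) (rule sum.swap)
  have le: "holder_mean q (cum_utility T b x) \<le> ?G (\<lambda>t. \<xi> (b t))" if x: "x \<in> ?X" for x
  proof -
    have "holder_mean q (cum_utility T b x) \<le> ?G x"
    proof (rule price_vector_def[THEN iffD1, OF g, THEN conjunct1, rule_format])
      fix i
      show "0 \<le> cum_utility T b x $ i \<and> ((\<forall>\<beta>\<in>set_pmf P. \<beta> $ i = 0) \<longrightarrow> cum_utility T b x $ i = 0)"
        using x b unfolding cum_utility_def
        by (auto intro!: sum_nonneg mult_nonneg_nonneg simp: atomD[OF adm] simplex_allocD)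
    qed
    also have "\<dots> \<le> ?G (\<lambda>t. \<xi> (b t))"
      unfolding lin using x by (intro sum_mono price_vector_argmax[OF xi g] b) auto
    finally show ?thesis .
  qed
  have mem: "(\<lambda>t. \<xi> (b t)) \<in> ?X" using xi b by (auto simp: static_policy_def)
  show "static_welfare q T \<xi> b \<le> hindsight_opt q T b"
    unfolding static_welfare_def hindsight_opt_def
    using le mem by (intro cSUP_upper) (auto intro!: bdd_aboveI2)
  show "hindsight_opt q T b \<le> ?G (\<lambda>t. \<xi> (b t))"
    unfolding hindsight_opt_def using le mem by (intro cSUP_least) auto
qed

text \<open>Regret is nonnegative pathwise, so only the upper side matters. The majorant
  \<open>h\<close> may be any function of the sequence whose expectation can be bounded.\<close>

lemma abs_regret_le:
  assumes xi: "static_policy P \<xi>" and g: "price_vector q \<xi> g"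
    and C: "measure_pmf.expectation (arrivals P T) h \<le> C"
    and h: "\<And>b. (\<And>t. t \<in> {1..T} \<Longrightarrow> b t \<in> set_pmf P) \<Longrightarrow>
      (\<Sum>i\<in>UNIV. g i * cum_utility T b (\<lambda>t. \<xi> (b t)) $ i) - static_welfare q T \<xi> b \<le> h b"
  shows "\<bar>regret P q T \<xi>\<bar> \<le> C"
proof -
  have "measure_pmf.expectation (arrivals P T) (\<lambda>_. 0) \<le> regret P q T \<xi>"
    unfolding regret_def
  proof (intro expectation_mono_arrivals[OF adm])
    fix b assume "\<And>t. t \<in> {1..T} \<Longrightarrow> b t \<in> set_pmf P"
    from hindsight_gap(1)[OF xi g this] show "0 \<le> hindsight_opt q T b - static_welfare q T \<xi> b" by simp
  qed
  moreover have "regret P q T \<xi> \<le> measure_pmf.expectation (arrivals P T) h"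
    unfolding regret_def
  proof (intro expectation_mono_arrivals[OF adm])
    fix b assume b: "\<And>t. t \<in> {1..T} \<Longrightarrow> b t \<in> set_pmf P"
    show "hindsight_opt q T b - static_welfare q T \<xi> b \<le> h b"
      using hindsight_gap(2)[OF xi g, of T b] h[of b] b by fastforce
  qed
  ultimately show ?thesis using C by simp
qed

section \<open>Regret in the degenerate, linear and curved cases\<close>

lemma cum_utility_static:
  assumes "static_policy P \<xi>" "\<And>t. t \<in> {1..T} \<Longrightarrow> b t \<in> set_pmf P"
  shows "0 \<le> cum_utility T b (\<lambda>t. \<xi> (b t)) $ i"
    and "(\<And>\<beta>. \<beta> \<in> set_pmf P \<Longrightarrow> \<beta> $ i = 0) \<Longrightarrow> cum_utility T b (\<lambda>t. \<xi> (b t)) $ i = 0"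
  unfolding cum_utility_def using assms
  by (auto intro!: sum_nonneg mult_nonneg_nonneg simp: atomD[OF adm] static_policyD[OF assms(1)])

text \<open>When every attainable welfare is 0, the zero vector is a valid price vector.\<close>

lemma regret_bounded_degenerate:
  assumes "\<And>B. \<lbrakk>\<And>i. 0 \<le> B $ i; \<And>i. (\<And>\<beta>. \<beta> \<in> set_pmf P \<Longrightarrow> \<beta> $ i = 0) \<Longrightarrow> B $ i = 0\<rbrakk> \<Longrightarrow> holder_mean q B = 0"
    and xi: "static_policy P \<xi>"
  shows "\<bar>regret P q T \<xi>\<bar> \<le> 0"
proof (rule abs_regret_le[OF xi, where g = "\<lambda>_. 0" and h = "\<lambda>_. 0"])
  show "price_vector q \<xi> (\<lambda>_. 0)" unfolding price_vector_def using assms(1) by simp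
  fix b assume "\<And>t. t \<in> {1..T} \<Longrightarrow> b t \<in> set_pmf P"
  then show "(\<Sum>i\<in>UNIV. 0 * cum_utility T b (\<lambda>t. \<xi> (b t)) $ i) - static_welfare q T \<xi> b \<le> 0"
    using cum_utility_static(1)[OF xi] by (simp add: static_welfare_def holder_mean_nonneg)
qed simp

text \<open>At \<open>q = 1\<close> the welfare is its own linear bound, so the gap vanishes on
  every path.\<close>

lemma regret_bounded_linear:
  assumes "1 \<le> T" "fluid_policy P 1 T \<xi>"
  shows "\<bar>regret P 1 T \<xi>\<bar> \<le> 0"
proof -
  have xi: "static_policy P \<xi>"
    and opt: "\<And>\<xi>'. static_policy P \<xi>' \<Longrightarrow> holder_mean 1 (fluid_utility P \<xi>') \<le> holder_mean 1 (fluid_utility P \<xi>)"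
    using assms(2) unfolding fluid_policy_iff[OF adm assms(1)] by auto
  show ?thesis
  proof (rule abs_regret_le[OF xi, where g = "\<lambda>_. 1 / real CARD('n)" and h = "\<lambda>_. 0"])
    show "price_vector 1 \<xi> (\<lambda>_. 1 / real CARD('n))"
      unfolding price_vector_def
    proof (intro conjI allI impI)
      fix \<xi>' assume "static_policy P \<xi>'"
      then show "(\<Sum>i\<in>UNIV. 1 / real CARD('n) * fluid_utility P \<xi>' $ i)
          \<le> (\<Sum>i\<in>UNIV. 1 / real CARD('n) * fluid_utility P \<xi> $ i)"
        using opt[of \<xi>'] xi fluid_utility_nonneg[OF adm] by (simp only: holder_mean_1)
    qed (simp add: holder_mean_1)
    fix b assume "\<And>t. t \<in> {1..T} \<Longrightarrow> b t \<in> set_pmf P"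
    then show "(\<Sum>i\<in>UNIV. 1 / real CARD('n) * cum_utility T b (\<lambda>t. \<xi> (b t)) $ i) - static_welfare 1 T \<xi> b \<le> 0"
      using cum_utility_static(1)[OF xi] by (simp add: static_welfare_def holder_mean_1)
  qed simp
qed

lemma fluid_utility_pos:
  assumes "\<beta> \<in> set_pmf P" "\<beta> $ i \<noteq> 0" "static_policy P \<xi>" "\<And>\<beta>. \<beta> \<in> set_pmf P \<Longrightarrow> 0 < \<xi> \<beta> $ i"
  shows "0 < fluid_utility P \<xi> $ i"
proof -
  have "0 < \<beta> $ i" using atomD(1)[OF adm assms(1), of i] assms(2) by simp
  then have "0 < pmf P \<beta> * \<beta> $ i * \<xi> \<beta> $ i" using assms(1,4) by (simp add: pmf_positive)
  then show ?thesis
    unfolding fluid_utility_def vec_lambda_beta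
    by (intro sum_pos2[where i = \<beta>] finite_atoms[OF adm] assms(1) mult_nonneg_nonneg)
       (auto simp: atomD[OF adm] static_policyD[OF assms(3)])
qed

text \<open>The constant must not depend on the optimal policy, so it is built only from two
  explicit competitors, the equal split \<open>v\<close> and the single-agent policies
  \<open>w i\<close>, for which \<open>w i $ i\<close> is the mean of
  \<open>\<beta> $ i\<close>.\<close>

lemma regret_bounded_curved:
  assumes "q < 1" and active: "\<exists>i. \<exists>\<beta>\<in>set_pmf P. \<beta> $ i \<noteq> 0"
    and all_active: "\<And>i. q \<le> 0 \<Longrightarrow> \<exists>\<beta>\<in>set_pmf P. \<beta> $ i \<noteq> 0"
  shows "\<exists>C::real. \<forall>T::nat. 1 \<le> T \<longrightarrow> (\<forall>\<xi>. fluid_policy P q T \<xi> \<longrightarrow> \<bar>regret P q T \<xi>\<bar> \<le> C)"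
proof -
  define v where "v = fluid_utility P (\<lambda>_. \<chi> i. 1 / real CARD('n))"
  define w where "w i = fluid_utility P (\<lambda>_. axis i 1)" for i
  define D where "D = (\<Sum>j\<in>UNIV. (v $ j) powr q)"
  define C where "C = gap_const q D * (\<Sum>i\<in>UNIV. 1 / w i $ i)"
  have st_v: "static_policy P (\<lambda>_. \<chi> i. 1 / real CARD('n))"
    by (simp add: static_policy_def uniform_in_simplex_alloc)
  have st_w: "static_policy P (\<lambda>_. axis i 1)" for i
    by (simp add: static_policy_def axis_in_simplex_alloc)
  have v_pos: "0 < v $ i" if "\<exists>\<beta>\<in>set_pmf P. \<beta> $ i \<noteq> 0" for i
    using that unfolding v_def by (auto intro!: fluid_utility_pos st_v)
  have w_pos: "0 < w i $ i" if "\<exists>\<beta>\<in>set_pmf P. \<beta> $ i \<noteq> 0" for i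
    using that unfolding w_def by (auto intro!: fluid_utility_pos st_w)
  have v_nn: "0 \<le> v $ i" for i unfolding v_def by (rule fluid_utility_nonneg[OF adm st_v])
  have M_v: "0 < holder_mean q v"
    using active all_active v_pos v_nn by (intro holder_mean_pos) auto
  have D: "0 \<le> D" unfolding D_def by (intro sum_nonneg) auto
  have K: "0 \<le> gap_const q D" using D by (simp add: gap_const_def)
  have "\<bar>regret P q T \<xi>\<bar> \<le> C" if T: "1 \<le> T" and fl: "fluid_policy P q T \<xi>" for T \<xi>
  proof -
    have xi: "static_policy P \<xi>"
      and opt: "\<And>\<xi>'. static_policy P \<xi>' \<Longrightarrow> holder_mean q (fluid_utility P \<xi>') \<le> holder_mean q (fluid_utility P \<xi>)"
      using fl unfolding fluid_policy_iff[OF adm T] by auto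
    define u where "u = fluid_utility P \<xi>"
    define M where "M = holder_mean q u"
    define g where "g i = M * share q u i / u $ i" for i
    have u: "0 \<le> u $ i" "u $ i \<le> 1" for i
      unfolding u_def using fluid_utility_nonneg[OF adm xi] fluid_utility_le_one[OF adm xi] by auto
    have opt_mix: "holder_mean q ((1 - e) *\<^sub>R u + e *\<^sub>R fluid_utility P \<xi>') \<le> holder_mean q u"
      if "static_policy P \<xi>'" "0 < e" "e \<le> 1" for \<xi>' e
      using opt[OF static_policy_mix[OF xi that(1)], of e] that unfolding fluid_utility_mix u_def by simp
    have M: "0 < M" "M \<le> 1"
      using opt[OF st_v] M_v u \<open>q < 1\<close> unfolding M_def u_def v_def by (auto intro!: holder_mean_le_one)
    have u_pos: "0 < u $ i" if act: "\<exists>\<beta>\<in>set_pmf P. \<beta> $ i \<noteq> 0" for i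
    proof (cases "q \<le> 0")
      case True
      then show ?thesis using u(1) M(1) unfolding M_def by (intro holder_mean_pos_imp_pos)
    next
      case False
      have "v $ i \<le> 1" unfolding v_def by (rule fluid_utility_le_one[OF adm st_v])
      then show ?thesis
        using False \<open>q < 1\<close> u(1) v_nn v_pos[OF act] opt_mix[OF st_v, folded v_def]
        by (intro holder_mean_maximizer_pos[of q u v i]) auto
    qed
    have u_ex: "\<exists>i. 0 < u $ i" using active u_pos by blast
    have u_q: "0 < u $ i" if "q \<le> 0" for i using u_pos all_active[OF that] by blast
    have u_0: "\<beta> $ i = 0" if "u $ i = 0" "\<beta> \<in> set_pmf P" for i \<beta> using u_pos[of i] that by auto
    \<comment> \<open>As \<open>u $ i \<le> 1\<close> and \<open>q \<le> 0\<close>, each power is at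
      least 1, while optimality against \<open>v\<close> bounds their sum by
      \<open>D\<close>.\<close>
    have D_share: "1 \<le> D * share q u i" if "q \<le> 0" for i
    proof -
      have "1 \<le> (u $ i) powr q"
        using u(2)[of i] u_q[OF that, of i] that powr_mono2'[of q "u $ i" 1] by simp
      moreover have "(\<Sum>j\<in>UNIV. (u $ j) powr q) \<le> D"
        unfolding D_def using opt[OF st_v] u_q[OF that] v_pos[OF all_active[OF that]] that
        by (intro holder_mean_le_imp_sum_powr_ge) (auto simp: u_def v_def)
      moreover have "0 < (\<Sum>j\<in>UNIV. (u $ j) powr q)" by (rule sum_powr_pos[OF u_ex])
      ultimately have "(\<Sum>j\<in>UNIV. (u $ j) powr q) * 1 \<le> D * (u $ i) powr q"
        by (intro mult_mono) auto
      then show ?thesis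
        using \<open>0 < (\<Sum>j\<in>UNIV. (u $ j) powr q)\<close> by (simp add: share_def field_simps)
    qed
    have first_order: "(\<Sum>i\<in>UNIV. g i * fluid_utility P \<xi>' $ i) \<le> M" if st: "static_policy P \<xi>'" for \<xi>'
    proof -
      have "(\<Sum>i\<in>UNIV. share q u i * (fluid_utility P \<xi>' $ i / u $ i)) \<le> 1"
        using \<open>q < 1\<close> M(1) u_0 unfolding M_def
        by (intro holder_mean_first_order[OF u(1) fluid_utility_nonneg[OF adm st] _ u_q u_ex _ D D_share _ opt_mix[OF st]])
           (auto intro!: fluid_utility_eq_0)
      from mult_left_mono[OF this, of M] show ?thesis
        using M by (simp add: g_def sum_distrib_left mult_ac)
    qed
    have g_u: "(\<Sum>i\<in>UNIV. g i * u $ i) = M"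
    proof -
      have "g i * u $ i = M * share q u i" for i
        by (cases "u $ i = 0") (auto simp: g_def share_def)
      then show ?thesis using sum_share[OF u_ex, of q] by (simp flip: sum_distrib_left)
    qed
    have g_nn: "0 \<le> g i" for i
      unfolding g_def using M u by (intro divide_nonneg_nonneg mult_nonneg_nonneg share_nonneg) auto
    \<comment> \<open>Serving only agent \<open>i\<close> has priced value at most
      \<open>M \<le> 1\<close>, which bounds the price. If \<open>u $ i = 0\<close>, division by
      zero makes the price 0.\<close>
    have g_le: "g i \<le> 1 / w i $ i" for i
    proof (cases "u $ i = 0")
      case True
      then show ?thesis
        unfolding g_def w_def using fluid_utility_nonneg[OF adm st_w, of i] by simp
    next
      case False
      then have "\<exists>\<beta>\<in>set_pmf P. \<beta> $ i \<noteq> 0" using fluid_utility_eq_0 unfolding u_def by blast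
      then have wi: "0 < w i $ i" by (rule w_pos)
      have "g i * w i $ i \<le> (\<Sum>j\<in>UNIV. g j * w i $ j)"
        using g_nn fluid_utility_nonneg[OF adm st_w] unfolding w_def
        by (intro member_le_sum mult_nonneg_nonneg) auto
      also have "\<dots> \<le> 1" using first_order[OF st_w[of i]] M unfolding w_def by linarith
      finally show ?thesis using wi by (simp add: field_simps)
    qed
    have price: "price_vector q \<xi> g"
      unfolding price_vector_def
    proof (intro conjI allI impI)
      fix B :: "real ^ 'n"
      assume "\<forall>i. 0 \<le> B $ i \<and> ((\<forall>\<beta>\<in>set_pmf P. \<beta> $ i = 0) \<longrightarrow> B $ i = 0)"
      then show "holder_mean q B \<le> (\<Sum>i\<in>UNIV. g i * B $ i)"
        unfolding g_def M_def using \<open>q < 1\<close> u(1) u_0 u_q u_ex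
        by (intro holder_mean_le_linear) auto
    next
      fix \<xi>' assume "static_policy P \<xi>'"
      from first_order[OF this] g_u
      show "(\<Sum>i\<in>UNIV. g i * fluid_utility P \<xi>' $ i) \<le> (\<Sum>i\<in>UNIV. g i * fluid_utility P \<xi> $ i)"
        by (simp add: u_def)
    qed
    \<comment> \<open>This is \<open>T\<close> times the second-order gap at the average utility
      \<open>B / T\<close>, with the squared relative deviations rewritten for the cumulative
      utilities.\<close>
    define h where "h b = gap_const q D *
      (\<Sum>i\<in>UNIV. g i / (real T * u $ i) * (cum_utility T b (\<lambda>t. \<xi> (b t)) $ i - real T * u $ i)\<^sup>2)" for b
    show ?thesis
    proof (rule abs_regret_le[OF xi price])
      fix b assume b: "\<And>t. t \<in> {1..T} \<Longrightarrow> b t \<in> set_pmf P"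
      define B where "B = cum_utility T b (\<lambda>t. \<xi> (b t))"
      define A where "A = (1 / real T) *\<^sub>R B"
      have B: "0 \<le> B $ i" "u $ i = 0 \<Longrightarrow> B $ i = 0" for i
        unfolding B_def using cum_utility_static[OF xi b] u_0 by auto
      have A: "0 \<le> A $ i" "u $ i = 0 \<Longrightarrow> A $ i = 0" for i using B by (auto simp: A_def)
      have B_A: "B = real T *\<^sub>R A" using T by (simp add: A_def)
      have "M * (\<Sum>i\<in>UNIV. share q u i * (A $ i / u $ i)) - holder_mean q A
          \<le> M * (gap_const q D * (\<Sum>i\<in>UNIV. share q u i * (A $ i / u $ i - 1)\<^sup>2))"
        unfolding M_def using u(1) A u_q u_ex \<open>q < 1\<close> D D_share by (intro holder_mean_gap_le) auto
      then have "real T * (M * (\<Sum>i\<in>UNIV. share q u i * (A $ i / u $ i)) - holder_mean q A)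
          \<le> real T * (M * (gap_const q D * (\<Sum>i\<in>UNIV. share q u i * (A $ i / u $ i - 1)\<^sup>2)))"
        by (intro mult_left_mono) auto
      moreover have "real T * (M * (\<Sum>i\<in>UNIV. share q u i * (A $ i / u $ i))) = (\<Sum>i\<in>UNIV. g i * B $ i)"
        by (simp add: B_A g_def sum_distrib_left mult_ac)
      moreover have "real T * holder_mean q A = holder_mean q B"
        unfolding B_A using T A by (subst holder_mean_scale) auto
      moreover have "real T * (M * (gap_const q D * (\<Sum>i\<in>UNIV. share q u i * (A $ i / u $ i - 1)\<^sup>2))) = h b"
      proof -
        have summand: "real T * (M * (share q u i * (A $ i / u $ i - 1)\<^sup>2)) = g i / (real T * u $ i) * (B $ i - real T * u $ i)\<^sup>2" for i
        proof (cases "u $ i = 0")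
          case False
          have "B $ i - real T * u $ i = real T * u $ i * (A $ i / u $ i - 1)"
            using False by (simp add: B_A field_simps)
          then show ?thesis using False T by (simp add: g_def power_mult_distrib power2_eq_square)
        qed (simp add: share_def)
        show ?thesis unfolding h_def B_def[symmetric] summand[symmetric]
          by (simp add: sum_distrib_left mult_ac)
      qed
      ultimately show "(\<Sum>i\<in>UNIV. g i * cum_utility T b (\<lambda>t. \<xi> (b t)) $ i) - static_welfare q T \<xi> b \<le> h b"
        unfolding static_welfare_def B_def by (simp add: right_diff_distrib)
    next
      let ?E = "measure_pmf.expectation (arrivals P T)"
      let ?d = "\<lambda>i b. (cum_utility T b (\<lambda>t. \<xi> (b t)) $ i - real T * u $ i)\<^sup>2"
      have "?E h = gap_const q D * (\<Sum>i\<in>UNIV. g i / (real T * u $ i) * ?E (?d i))"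
        unfolding h_def using integrable_arrivals[OF adm] by simp
      also have "\<dots> \<le> gap_const q D * (\<Sum>i\<in>UNIV. 1 / w i $ i)"
      proof (intro mult_left_mono[OF _ K] sum_mono)
        fix i
        \<comment> \<open>The variance bound \<open>T * u $ i\<close> cancels the denominator, so
          neither \<open>T\<close> nor a possibly small \<open>u $ i\<close> remains.\<close>
        have "g i / (real T * u $ i) * ?E (?d i) \<le> g i / (real T * u $ i) * (real T * u $ i)"
          using g_nn u expectation_deviation_sq[OF adm xi, of T i] unfolding u_def
          by (intro mult_left_mono) auto
        also have "\<dots> \<le> g i" using g_nn T by (cases "u $ i = 0") auto
        finally show "g i / (real T * u $ i) * ?E (?d i) \<le> 1 / w i $ i" using g_le[of i] by linarith
      qed
      finally show "?E h \<le> C" by (simp add: C_def)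
    qed
  qed
  then show ?thesis by blast
qed

end

theorem theorem1:
  fixes P :: "(real ^ 'n) pmf" and q :: real
  assumes "admissible P" and "q \<le> 1"
  shows "\<exists>C::real. \<forall>T::nat. 1 \<le> T \<longrightarrow>
           (\<forall>\<xi>. fluid_policy P q T \<xi> \<longrightarrow> \<bar>regret P q T \<xi>\<bar> \<le> C)"
proof -
  note adm = assms(1)
  have static: "static_policy P \<xi>" if "fluid_policy P q T \<xi>" for T \<xi>
    using that by (simp add: fluid_policy_def)
  \<comment> \<open>The second and third cases have identically zero welfare: one agent without any
    positive utility suffices for \<open>q \<le> 0\<close>, whereas for \<open>q > 0\<close> all
    agents must be such.\<close>
  consider "q = 1"
    | "q \<le> 0" "\<exists>i. \<forall>\<beta>\<in>set_pmf P. \<beta> $ i = 0"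
    | "0 < q" "\<forall>i. \<forall>\<beta>\<in>set_pmf P. \<beta> $ i = 0"
    | "q < 1" "\<exists>i. \<exists>\<beta>\<in>set_pmf P. \<beta> $ i \<noteq> 0" "q \<le> 0 \<longrightarrow> (\<forall>i. \<exists>\<beta>\<in>set_pmf P. \<beta> $ i \<noteq> 0)"
    using assms(2) by (metis less_eq_real_def not_le)
  then show ?thesis
  proof cases
    case 1
    then show ?thesis using regret_bounded_linear[OF adm] by blast
  next
    case 2
    then obtain i where i: "\<And>\<beta>. \<beta> \<in> set_pmf P \<Longrightarrow> \<beta> $ i = 0" by auto
    have "holder_mean q B = 0"
      if "\<And>i. (\<And>\<beta>. \<beta> \<in> set_pmf P \<Longrightarrow> \<beta> $ i = 0) \<Longrightarrow> B $ i = 0" for B :: "real ^ 'n"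
      using that[OF i] 2(1) by (auto simp: holder_mean_def dest: spec[of _ i])
    then show ?thesis using regret_bounded_degenerate[OF adm _ static] by blast
  next
    case 3
    have "holder_mean q B = 0"
      if "\<And>i. (\<And>\<beta>. \<beta> \<in> set_pmf P \<Longrightarrow> \<beta> $ i = 0) \<Longrightarrow> B $ i = 0" for B :: "real ^ 'n"
      using that 3 by (simp add: holder_mean_def)
    then show ?thesis using regret_bounded_degenerate[OF adm _ static] by blast
  next
    case 4
    then show ?thesis using regret_bounded_curved[OF adm] by blast
  qed
qed

end
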